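(* Let $P \subset \mathbb{P}^3$ be the quartic hypersurface over $\mathbb{C}$, in homogeneous coordinates $(u,v,\alpha,\beta)$, defined by $$P(u,v,\alpha,\beta) := -u^2v^2 - \tfrac{9}{8}\,uv\,\alpha\beta + \beta v^3 + \alpha u^3 + \tfrac{27}{16^2}\,\alpha^2\beta^2 = 0 .$$ Then $P$ is irreducible, and its singular locus is a twisted cubic curve $\Gamma$, which is a cuspidal curve for $P$. In particular $P$ is projectively unique (every irreducible quartic surface in $\mathbb{P}^3$ having a twisted cubic as a cuspidal curve is projectively equivalent to $P$), being the dual surface of a twisted cubic curve. Moreover $P$ is the tangential developable of the twisted cubic $\Gamma$, and, up to projective equivalence, $P$ is the discriminant surface in the space $\mathbb{P}^3$ of (nonzero, up to scalars) polynomials of degree $3$ on $\mathbb{P}^1$.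
   Context: Everything is over $\mathbb{C}$. A twisted cubic is a curve in $\mathbb{P}^3$ projectively equivalent to the image of $\mathbb{P}^1$ under $(t_0,t_1)\mapsto (t_0^3,t_0^2t_1,t_0t_1^2,t_1^3)$. The singular locus is understood as a set. A curve $\Gamma$ contained in the singular locus of a surface $X\subset\mathbb{P}^3$ is a cuspidal curve for $X$ if the intersection of $X$ with a general plane has, at each of its points on $\Gamma$, a cusp (a singularity locally analytically equivalent to $y^2=x^3$). The tangential developable of a space curve is the closure of the union of its tangent lines. The dual surface of a twisted cubic $D$ contained in a projective space of dimension $3$ is the surface in the dual projective space consisting of the planes which are tangent to $D$ at some point (i.e. contain a tangent line of $D$). The discriminant surface is the set of classes of nonzero binary cubic forms having a multiple root. *)

theory Defs
  imports
    "HOL-Analysis.Analysis"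
    "HOL-Library.Poly_Mapping"
    "HOL-Computational_Algebra.Factorial_Ring"
begin

section \<open>Polynomials in variables indexed by a finite type\<close>

text \<open>An exponent vector is a finitely supported function from variables to natural numbers, and a
  polynomial is a finitely supported function from exponent vectors to coefficients. The ring
  structure on \<^typ>\<open>('n \<Rightarrow>\<^sub>0 nat) \<Rightarrow>\<^sub>0 complex\<close> provided by the library is the polynomial ring.\<close>

type_synonym 'n mpoly = "('n \<Rightarrow>\<^sub>0 nat) \<Rightarrow>\<^sub>0 complex"

definition mvar :: "'n \<Rightarrow> 'n mpoly" where
  "mvar i = Poly_Mapping.single (Poly_Mapping.single i 1) 1"

definition mconst :: "complex \<Rightarrow> 'n mpoly" where
  "mconst c = Poly_Mapping.single 0 c"

definition meval :: "'n::finite mpoly \<Rightarrow> complex ^ 'n \<Rightarrow> complex" where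
  "meval F x = (\<Sum>m\<in>Poly_Mapping.keys F.
     Poly_Mapping.lookup F m * (\<Prod>i\<in>UNIV. (x $ i) ^ Poly_Mapping.lookup m i))"

definition homogeneous :: "nat \<Rightarrow> 'n::finite mpoly \<Rightarrow> bool" where
  "homogeneous d F \<longleftrightarrow>
     (\<forall>m\<in>Poly_Mapping.keys F. (\<Sum>i\<in>UNIV. Poly_Mapping.lookup m i) = d)"

definition gradient :: "'n::finite mpoly \<Rightarrow> complex ^ 'n \<Rightarrow> complex ^ 'n" where
  "gradient F x = (\<chi> i. deriv (\<lambda>c. meval F (x + c *s axis i 1)) 0)"


section \<open>Projective space\<close>

text \<open>Points of the projective space of \<^typ>\<open>complex ^ 'n\<close> are one-dimensional linear subspaces;
  subvarieties are sets of points. The dual space is identified with \<^typ>\<open>complex ^ 'n\<close> by the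
  bilinear (not Hermitian) pairing \<^const>\<open>scalar_product\<close>; under this identification the bidual
  of a projective space is that space itself.\<close>

definition pt :: "complex ^ 'n \<Rightarrow> (complex ^ 'n) set" where
  "pt x = vec.span {x}"

definition projectivization :: "(complex ^ 'n) set \<Rightarrow> (complex ^ 'n) set set" where
  "projectivization W = {pt x | x. x \<in> W \<and> x \<noteq> 0}"

definition is_line :: "(complex ^ 'n) set set \<Rightarrow> bool" where
  "is_line L \<longleftrightarrow> (\<exists>W. vec.subspace W \<and> vec.dim W = 2 \<and> L = projectivization W)"

definition hyperplane :: "complex ^ 'n \<Rightarrow> (complex ^ 'n) set set" where
  "hyperplane h = projectivization {x. scalar_product h x = 0}"

definition zero_locus :: "'n::finite mpoly \<Rightarrow> (complex ^ 'n) set set" where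
  "zero_locus F = projectivization {x. meval F x = 0}"

definition singular_locus :: "'n::finite mpoly \<Rightarrow> (complex ^ 'n) set set" where
  "singular_locus F = projectivization {x. meval F x = 0 \<and> gradient F x = 0}"

definition zariski_closure :: "(complex ^ 'n) set set \<Rightarrow> (complex ^ 'n::finite) set set" where
  "zariski_closure S =
     {p \<in> projectivization UNIV. \<forall>F d. homogeneous d F \<and> S \<subseteq> zero_locus F \<longrightarrow> p \<in> zero_locus F}"

definition projectively_equivalent ::
    "(complex ^ 'n) set set \<Rightarrow> (complex ^ 'n::finite) set set \<Rightarrow> bool" where
  "projectively_equivalent X Y \<longleftrightarrow>
     (\<exists>A :: complex ^ 'n ^ 'n. invertible A \<and> Y = (\<lambda>p. (\<lambda>x. A *v x) ` p) ` X)"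

text \<open>A property holds for the general hyperplane if it holds on a nonempty Zariski open subset of
  the dual projective space. Every such subset contains the complement of a hypersurface.\<close>

definition for_general_hyperplane :: "(complex ^ 'n::finite \<Rightarrow> bool) \<Rightarrow> bool" where
  "for_general_hyperplane Q \<longleftrightarrow>
     (\<exists>d (G :: 'n mpoly). homogeneous d G \<and> G \<noteq> 0 \<and> (\<forall>h. h \<noteq> 0 \<and> meval G h \<noteq> 0 \<longrightarrow> Q h))"


section \<open>Twisted cubics, tangent lines, tangential developables and dual surfaces\<close>

definition twisted_cubic :: "(complex ^ 4) set set \<Rightarrow> bool" where
  "twisted_cubic C \<longleftrightarrow> projectively_equivalent
     {pt (vector [(t $ 1) ^ 3, (t $ 1) ^ 2 * t $ 2, t $ 1 * (t $ 2) ^ 2, (t $ 2) ^ 3]) | t :: complex ^ 2.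
        t \<noteq> 0} C"

text \<open>The embedded projective (Zariski) tangent space of a closed subset \<open>C\<close> with its reduced
  structure at the point \<open>p\<close>. For a curve it is a line exactly when \<open>p\<close> is a smooth point.\<close>

definition tangent_space ::
    "(complex ^ 'n) set set \<Rightarrow> (complex ^ 'n) set \<Rightarrow> (complex ^ 'n::finite) set set" where
  "tangent_space C p = projectivization
     {y. \<forall>F d. homogeneous d F \<and> C \<subseteq> zero_locus F \<longrightarrow>
           (\<forall>x\<in>p - {0}. scalar_product (gradient F x) y = 0)}"

definition tangent_lines :: "(complex ^ 'n) set set \<Rightarrow> (complex ^ 'n::finite) set set set" where
  "tangent_lines C = {L. is_line L \<and> (\<exists>p\<in>C. L = tangent_space C p)}"

definition tangential_developable ::
    "(complex ^ 'n) set set \<Rightarrow> (complex ^ 'n::finite) set set" where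
  "tangential_developable C = zariski_closure (\<Union> (tangent_lines C))"

definition dual_surface :: "(complex ^ 4) set set \<Rightarrow> (complex ^ 4) set set" where
  "dual_surface D = {pt h | h. h \<noteq> 0 \<and> (\<exists>L\<in>tangent_lines D. L \<subseteq> hyperplane h)}"


section \<open>Cuspidal curves\<close>

definition holomorphic_map_on ::
    "(complex ^ 'n::finite \<Rightarrow> complex ^ 'm::finite) \<Rightarrow> (complex ^ 'n) set \<Rightarrow> bool" where
  "holomorphic_map_on f U \<longleftrightarrow>
     (\<forall>x\<in>U. \<exists>M :: complex ^ 'n ^ 'm. (f has_derivative (\<lambda>v. M *v v)) (at x))"

definition holomorphic_fun_on ::
    "(complex ^ 'n::finite \<Rightarrow> complex) \<Rightarrow> (complex ^ 'n) set \<Rightarrow> bool" where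
  "holomorphic_fun_on f U \<longleftrightarrow>
     (\<forall>x\<in>U. \<exists>a. (f has_derivative (\<lambda>v. scalar_product a v)) (at x))"

text \<open>The germ of \<open>{f = 0}\<close> at \<open>p\<close> is isomorphic, as a germ of complex spaces, to the germ of
  \<open>{g = 0}\<close> at \<open>q\<close>: a local biholomorphism carries \<open>f\<close> to \<open>g\<close> times a unit. The factor \<open>e\<close> accounts
  for the local equation being determined only up to a unit.\<close>

definition locally_analytically_equivalent ::
    "(complex ^ 'n::finite \<Rightarrow> complex) \<Rightarrow> complex ^ 'n \<Rightarrow>
     (complex ^ 'n \<Rightarrow> complex) \<Rightarrow> complex ^ 'n \<Rightarrow> bool" where
  "locally_analytically_equivalent f p g q \<longleftrightarrow>
     (\<exists>U V \<phi> \<psi> e. open U \<and> q \<in> U \<and> open V \<and> p \<in> V \<and>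
        holomorphic_map_on \<phi> U \<and> holomorphic_map_on \<psi> V \<and>
        \<phi> ` U = V \<and> (\<forall>z\<in>U. \<psi> (\<phi> z) = z) \<and> \<phi> q = p \<and>
        holomorphic_fun_on e U \<and> (\<forall>z\<in>U. e z \<noteq> 0) \<and>
        (\<forall>z\<in>U. f (\<phi> z) = e z * g z))"

definition cusp_at :: "(complex ^ 2 \<Rightarrow> complex) \<Rightarrow> complex ^ 2 \<Rightarrow> bool" where
  "cusp_at f p \<longleftrightarrow> locally_analytically_equivalent f p (\<lambda>z. (z $ 2) ^ 2 - (z $ 1) ^ 3) 0"

text \<open>The span condition makes \<open>x, y, z\<close> a basis of the three-dimensional space underlying the plane
  \<open>h\<close> (for nonzero \<open>h\<close>), so that \<open>(s, t) \<mapsto> pt (x + s y + t z)\<close> is an affine chart of this plane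
  centred at \<open>p\<close>, in which \<open>F (x + s y + t z)\<close> is an equation of the plane section.\<close>

definition plane_section_has_cusp_at ::
    "4 mpoly \<Rightarrow> complex ^ 4 \<Rightarrow> (complex ^ 4) set \<Rightarrow> bool" where
  "plane_section_has_cusp_at F h p \<longleftrightarrow>
     (\<exists>x y z. p = pt x \<and> vec.span {x, y, z} = {v. scalar_product h v = 0} \<and>
        cusp_at (\<lambda>w. meval F (x + w $ 1 *s y + w $ 2 *s z)) 0)"

definition cuspidal_curve :: "4 mpoly \<Rightarrow> (complex ^ 4) set set \<Rightarrow> bool" where
  "cuspidal_curve F C \<longleftrightarrow>
     C \<subseteq> singular_locus F \<and>
     for_general_hyperplane (\<lambda>h. \<forall>p \<in> C \<inter> hyperplane h. plane_section_has_cusp_at F h p)"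


section \<open>The quartic and the discriminant surface\<close>

text \<open>The coordinates \<open>(u, v, \<alpha>, \<beta>)\<close> have the indices 1, 2, 3, 4.\<close>

definition quartic_P :: "4 mpoly" where
  "quartic_P =
     (let u = mvar 1; v = mvar 2; \<alpha> = mvar 3; \<beta> = mvar 4 in
        - (u ^ 2 * v ^ 2) - mconst (9 / 8) * u * v * \<alpha> * \<beta> + \<beta> * v ^ 3 + \<alpha> * u ^ 3
        + mconst (27 / 16 ^ 2) * \<alpha> ^ 2 * \<beta> ^ 2)"

definition binary_cubic :: "complex ^ 4 \<Rightarrow> 2 mpoly" where
  "binary_cubic a =
     mconst (a $ 1) * mvar 1 ^ 3 + mconst (a $ 2) * mvar 1 ^ 2 * mvar 2
     + mconst (a $ 3) * mvar 1 * mvar 2 ^ 2 + mconst (a $ 4) * mvar 2 ^ 3"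

text \<open>The point \<open>(s\<^sub>1 : s\<^sub>2)\<close> of the projective line is a root of multiplicity at least two.\<close>

definition has_multiple_root :: "2 mpoly \<Rightarrow> bool" where
  "has_multiple_root f \<longleftrightarrow>
     (\<exists>s :: complex ^ 2. s \<noteq> 0 \<and> (mconst (s $ 2) * mvar 1 - mconst (s $ 1) * mvar 2) ^ 2 dvd f)"

definition discriminant_surface :: "(complex ^ 4) set set" where
  "discriminant_surface = projectivization {a. has_multiple_root (binary_cubic a)}"

end

theory Submission
  imports Defs
    "HOL-Computational_Algebra.Fundamental_Theorem_Algebra"
begin

text \<open>
  In suitable coordinates \<open>P\<close> is the discriminant of binary cubics, and all assertions can be checked
  for the discriminant form in the coordinates in which the cubes of linear forms make up the standard
  twisted cubic (lemma \<open>quartic_P_is_disc_form\<close>; all notions involved are compatible with projective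
  transformations).

  The discriminant of a binary cubic is the discriminant \<open>q\<^sub>1\<^sup>2 - 4 q\<^sub>0 q\<^sub>2\<close> of its Hessian, whose coefficients
  \<open>q\<^sub>0\<close>, \<open>q\<^sub>1\<close>, \<open>q\<^sub>2\<close> are the quadrics through the twisted cubic of cubes. Its partial derivatives have no
  common zeros besides those of the quadrics, so the singular locus is that cubic. It vanishes iff the binary cubic has a
  repeated factor, that is, iff it lies on the tangent line of the twisted cubic at the cube of this
  factor; hence the surface is the tangential developable. A plane is again a binary cubic, namely its
  pullback to the parameter line, and it contains a tangent line iff that cubic has a double root; hence
  the surface is also a dual surface.

  On a plane transversal to the twisted cubic, completing the cube writes the discriminant as
  \<open>q\<^sup>2 + 4 p\<^sup>3\<close> for local coordinates \<open>p\<close> and \<open>q\<close>; this is the cusp (\<open>cuspidal_curve_disc_form\<close>).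

  For uniqueness, a quartic singular along the twisted cubic is a quadratic form in \<open>q\<^sub>0\<close>, \<open>q\<^sub>1\<close>, \<open>q\<^sub>2\<close>
  (\<open>singular_quartic_is_quadric_form\<close>). At a cusp the quadratic part of the local equation is a square
  (\<open>cusp_at_zero_imp_degenerate\<close>), so at all but finitely many points of the cubic this form degenerates on the span of
  the differentials of the quadrics. That is one polynomial relation in the parameter of the point, and its
  only solutions are squares and multiples of the discriminant (\<open>discriminant_relation_solutions\<close>).

  Irreducibility follows from the singular locus being small: the surface is parametrized, so one of two
  factors vanishes on all of it, and then the zeros of the other factor are singular points of the surface.
  They have codimension two in the space of cubics, whereas a nonconstant polynomial has a hypersurface
  of zeros (\<open>cofactor_of_vanishing_factor_is_unit\<close>).
\<close>


section \<open>Polynomials and polynomial functions\<close>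

lemma mpoly_sum_of_monomials:
  "(\<Sum>m\<in>Poly_Mapping.keys F. Poly_Mapping.single m (Poly_Mapping.lookup F m)) = F"
proof (rule poly_mapping_eqI)
  fix k
  have "Poly_Mapping.lookup (\<Sum>m\<in>Poly_Mapping.keys F. Poly_Mapping.single m (Poly_Mapping.lookup F m)) k
      = (\<Sum>m\<in>Poly_Mapping.keys F. if m = k then Poly_Mapping.lookup F m else 0)"
    unfolding lookup_sum by (intro sum.cong) (auto simp: lookup_single when_def)
  also have "\<dots> = Poly_Mapping.lookup F k"
    by (auto simp: in_keys_iff)
  finally show "Poly_Mapping.lookup (\<Sum>m\<in>Poly_Mapping.keys F.
      Poly_Mapping.single m (Poly_Mapping.lookup F m)) k = Poly_Mapping.lookup F k" .
qed

lemma single_eq_const_mult_vars: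
  "Poly_Mapping.single m c = mconst c * (\<Prod>i\<in>Poly_Mapping.keys m. mvar i ^ Poly_Mapping.lookup m i)"
proof -
  have pow: "mvar i ^ k = Poly_Mapping.single (Poly_Mapping.single i k) 1" for i :: 'a and k
    by (induction k) (auto simp: mvar_def mult_single single_add[symmetric])
  have "(\<Prod>i\<in>S. mvar i ^ Poly_Mapping.lookup m i) =
      Poly_Mapping.single (\<Sum>i\<in>S. Poly_Mapping.single i (Poly_Mapping.lookup m i)) (1::complex)"
    if "finite S" for S
    using that by (induction S) (auto simp: pow mult_single)
  moreover have "(\<Sum>i\<in>Poly_Mapping.keys m. Poly_Mapping.single i (Poly_Mapping.lookup m i)) = m"
  proof (rule poly_mapping_eqI)
    fix k
    have "Poly_Mapping.lookup (\<Sum>i\<in>Poly_Mapping.keys m. Poly_Mapping.single i (Poly_Mapping.lookup m i)) k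
      = (\<Sum>i\<in>Poly_Mapping.keys m. if i = k then Poly_Mapping.lookup m i else 0)"
      unfolding lookup_sum by (intro sum.cong) (auto simp: lookup_single when_def)
    also have "\<dots> = Poly_Mapping.lookup m k"
      by (auto simp: in_keys_iff)
    finally show "Poly_Mapping.lookup (\<Sum>i\<in>Poly_Mapping.keys m.
      Poly_Mapping.single i (Poly_Mapping.lookup m i)) k = Poly_Mapping.lookup m k" .
  qed
  ultimately show ?thesis
    by (simp add: mconst_def mult_single)
qed

text \<open>Polynomials are generated by constants and variables, so statements compatible with sums and
  products, such as the chain rule, need to be checked only on these generators.\<close>

lemma mpoly_induct [case_names const var add mult]:
  assumes const: "\<And>c. Q (mconst c)" and var: "\<And>i. Q (mvar i)"
    and add: "\<And>F G. Q F \<Longrightarrow> Q G \<Longrightarrow> Q (F + G)" and mult: "\<And>F G. Q F \<Longrightarrow> Q G \<Longrightarrow> Q (F * G)"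
  shows "Q F"
proof -
  have one: "Q 1" using const[of 1] by (simp add: mconst_def)
  have zero: "Q 0" using const[of 0] by (simp add: mconst_def)
  have pow: "Q (mvar i ^ k)" for i k
    by (induction k) (auto intro: one mult var)
  have "Q (\<Prod>i\<in>S. mvar i ^ k i)" if "finite S" for S k
    using that by (induction S) (auto intro: one mult pow)
  then have mono: "Q (Poly_Mapping.single m c)" for m c
    unfolding single_eq_const_mult_vars by (auto intro: mult const)
  have "Q (\<Sum>m\<in>S. Poly_Mapping.single m (k m))" if "finite S" for S k
    using that by (induction S) (auto intro: zero add mono)
  then show ?thesis
    by (metis mpoly_sum_of_monomials finite_keys)
qed

lemma meval_superset:
  assumes "finite S" "Poly_Mapping.keys F \<subseteq> S"
  shows "meval F x = (\<Sum>m\<in>S. Poly_Mapping.lookup F m * (\<Prod>i\<in>UNIV. (x $ i) ^ Poly_Mapping.lookup m i))"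
  unfolding meval_def using assms
  by (intro sum.mono_neutral_left) (auto simp: in_keys_iff)

lemma meval_add [simp]: "meval (F + G) x = meval F x + meval G x"
proof -
  define S where "S = Poly_Mapping.keys F \<union> Poly_Mapping.keys G"
  have S: "finite S" "Poly_Mapping.keys F \<subseteq> S" "Poly_Mapping.keys G \<subseteq> S"
      "Poly_Mapping.keys (F + G) \<subseteq> S"
    using keys_add[of F G] by (auto simp: S_def)
  show ?thesis
    by (simp add: meval_superset[OF S(1,2)] meval_superset[OF S(1,3)] meval_superset[OF S(1,4)]
        lookup_add algebra_simps sum.distrib)
qed

lemma meval_zero [simp]: "meval 0 x = 0"
  by (simp add: meval_def)

lemma meval_single: "meval (Poly_Mapping.single m c) x = c * (\<Prod>i\<in>UNIV. (x $ i) ^ Poly_Mapping.lookup m i)"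
  by (simp add: meval_def)

lemma meval_const [simp]: "meval (mconst c) x = c"
  by (simp add: mconst_def meval_single)

lemma meval_one [simp]: "meval 1 x = 1"
  using meval_const[of 1 x] by (simp add: mconst_def)

lemma meval_var [simp]: "meval (mvar i) x = x $ i"
proof -
  have "(\<Prod>j\<in>UNIV. (x $ j) ^ (if i = j then Suc 0 else 0)) = (\<Prod>j\<in>UNIV. if i = j then x $ j else 1)"
    by (intro prod.cong) auto
  then show ?thesis
    by (simp add: mvar_def meval_single lookup_single when_def)
qed

lemma meval_sum [simp]: "meval (\<Sum>a\<in>S. f a) x = (\<Sum>a\<in>S. meval (f a) x)"
  by (induction S rule: infinite_finite_induct) auto

lemma meval_mult [simp]: "meval (F * G) x = meval F x * meval G x"
proof -
  have single: "meval (Poly_Mapping.single m c * Poly_Mapping.single n d) x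
      = meval (Poly_Mapping.single m c) x * meval (Poly_Mapping.single n d) x" for m n c d
    by (simp add: mult_single meval_single lookup_add power_add prod.distrib)
  have "meval (F * G) x = meval ((\<Sum>m\<in>Poly_Mapping.keys F. Poly_Mapping.single m (Poly_Mapping.lookup F m)) *
      (\<Sum>m\<in>Poly_Mapping.keys G. Poly_Mapping.single m (Poly_Mapping.lookup G m))) x"
    by (simp add: mpoly_sum_of_monomials)
  also have "\<dots> = meval (\<Sum>m\<in>Poly_Mapping.keys F. Poly_Mapping.single m (Poly_Mapping.lookup F m)) x *
      meval (\<Sum>m\<in>Poly_Mapping.keys G. Poly_Mapping.single m (Poly_Mapping.lookup G m)) x"
    unfolding sum_product meval_sum by (simp add: single)
  finally show ?thesis
    by (simp add: mpoly_sum_of_monomials)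
qed

lemma meval_minus [simp]: "meval (- F) x = - meval F x"
  using meval_add[of F "- F" x] by (simp add: eq_neg_iff_add_eq_0 add.commute)

lemma meval_diff [simp]: "meval (F - G) x = meval F x - meval G x"
  using meval_add[of F "- G" x] by simp

lemma meval_power [simp]: "meval (F ^ k) x = meval F x ^ k"
  by (induction k) auto

lemma meval_prod [simp]: "meval (\<Prod>a\<in>S. f a) x = (\<Prod>a\<in>S. meval (f a) x)"
  by (induction S rule: infinite_finite_induct) auto

text \<open>Monomials are pairwise distinct multiplicative characters of the monoid of all vectors under
  componentwise multiplication, so Dedekind's argument shows that they are linearly independent.\<close>

lemma monomials_independent:
  fixes c :: "('n::finite \<Rightarrow>\<^sub>0 nat) \<Rightarrow> complex"
  assumes "finite S" "\<And>x :: complex ^ 'n. (\<Sum>m\<in>S. c m * (\<Prod>i\<in>UNIV. (x $ i) ^ Poly_Mapping.lookup m i)) = 0"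
    "m \<in> S"
  shows "c m = 0"
  using assms
proof (induction S arbitrary: c m rule: finite_induct)
  case empty
  then show ?case by simp
next
  case (insert k S)
  define ch where "ch m x = (\<Prod>i\<in>UNIV. (x $ i) ^ Poly_Mapping.lookup m i)"
    for m :: "'n \<Rightarrow>\<^sub>0 nat" and x :: "complex ^ 'n"
  have mul: "ch m (\<chi> i. x $ i * y $ i) = ch m x * ch m y" for m x y
    by (simp add: ch_def power_mult_distrib prod.distrib)
  have tot: "c k * ch k x + (\<Sum>m\<in>S. c m * ch m x) = 0" for x
    using insert.prems(1)[of x] insert.hyps by (simp add: ch_def)
  have "c m = 0" if m: "m \<in> S" for m
  proof -
    have "m \<noteq> k" using m insert.hyps by auto
    then obtain i where i: "Poly_Mapping.lookup m i \<noteq> Poly_Mapping.lookup k i"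
      by (metis poly_mapping_eqI)
    define y :: "complex ^ 'n" where "y = (\<chi> j. if j = i then 2 else 1)"
    have chi_y: "ch n y = 2 ^ Poly_Mapping.lookup n i" for n
    proof -
      have "ch n y = (\<Prod>j\<in>UNIV. if j = i then 2 ^ Poly_Mapping.lookup n j else 1)"
        unfolding ch_def y_def by (intro prod.cong) auto
      then show ?thesis by simp
    qed
    have pow2: "(2::complex) ^ a = 2 ^ b \<longleftrightarrow> a = b" for a b :: nat
      by (metis of_nat_eq_iff of_nat_numeral of_nat_power one_less_numeral_iff power_inject_exp semiring_norm(76))
    \<comment> \<open>Evaluating the relation at the product with y and subtracting a multiple of it removes k.\<close>
    have "(\<Sum>m\<in>S. (c m * (ch m y - ch k y)) * (\<Prod>i\<in>UNIV. (x $ i) ^ Poly_Mapping.lookup m i)) = 0" for x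
    proof -
      have "(\<Sum>m\<in>S. (c m * (ch m y - ch k y)) * ch m x)
          = (c k * ch k (\<chi> i. x $ i * y $ i) + (\<Sum>m\<in>S. c m * ch m (\<chi> i. x $ i * y $ i)))
            - ch k y * (c k * ch k x + (\<Sum>m\<in>S. c m * ch m x))"
        by (simp add: mul algebra_simps sum_subtractf sum_distrib_left)
      then show ?thesis by (simp add: tot) (simp add: ch_def)
    qed
    from insert.IH[OF this m] show ?thesis
      using i by (simp add: chi_y pow2)
  qed
  moreover from this have "c k = 0"
    using tot[of "\<chi> i. 1"] by (simp add: ch_def)
  ultimately show ?case using insert.prems(2) by auto
qed

lemma mpoly_eq_zeroI:
  assumes "\<And>x. meval F x = 0"
  shows "F = 0"
proof (rule ccontr)
  assume "F \<noteq> 0"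
  then obtain m where m: "m \<in> Poly_Mapping.keys F" by (metis keys_eq_empty ex_in_conv)
  have "Poly_Mapping.lookup F m = 0"
    by (rule monomials_independent[OF finite_keys _ m]) (use assms in \<open>simp add: meval_def\<close>)
  with m show False by (simp add: in_keys_iff)
qed

lemma mpoly_eqI:
  assumes "\<And>x. meval F x = meval G x"
  shows "F = G"
  using mpoly_eq_zeroI[of "F - G"] assms by simp

lemma meval_on_line:
  fixes x v :: "complex ^ 'n::finite"
  obtains p where "\<And>t. meval F (x + t *s v) = poly p t"
proof -
  have "\<exists>p. \<forall>t. meval F (x + t *s v) = poly p t"
  proof (induction F rule: mpoly_induct)
    case (const c)
    show ?case by (rule exI[of _ "[:c:]"]) simp
  next
    case (var i)
    show ?case by (rule exI[of _ "[:x $ i, v $ i:]"]) simp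
  next
    case (add F G)
    then show ?case by (metis meval_add poly_add)
  next
    case (mult F G)
    then show ?case by (metis meval_mult poly_mult)
  qed
  then show thesis using that by blast
qed

lemma infinite_near_zero:
  fixes r :: real
  assumes "r > 0" shows "infinite {t :: complex. norm t < r}"
proof -
  have "{t :: complex. norm t < r} = ball 0 r" by auto
  moreover have "uncountable (ball (0::complex) r)" using assms by (rule uncountable_ball)
  ultimately show ?thesis using countable_finite by metis
qed

lemma continuous_smult_line: "continuous_on UNIV (\<lambda>t. x + t *s (v :: complex ^ 'n))"
  by (intro continuous_on_vec_lambda continuous_intros | simp add: vector_scalar_mult_def)+

text \<open>Restricted to a line through a point of the open set, the polynomial has infinitely many zeros.\<close>

lemma mpoly_eq_zero_on_open:
  fixes F :: "'n::finite mpoly"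
  assumes "open U" "x\<^sub>0 \<in> U" and zero: "\<And>x. x \<in> U \<Longrightarrow> meval F x = 0"
  shows "F = 0"
proof (rule mpoly_eq_zeroI)
  fix x
  define v where "v = x - x\<^sub>0"
  obtain p where p: "\<And>t. meval F (x\<^sub>0 + t *s v) = poly p t"
    using meval_on_line by blast
  have "open ((\<lambda>t. x\<^sub>0 + t *s v) -` U)"
    using assms(1) continuous_smult_line by (rule open_vimage)
  moreover have "0 \<in> (\<lambda>t. x\<^sub>0 + t *s v) -` U" using assms(2) by simp
  ultimately obtain r where r: "r > 0" "ball 0 r \<subseteq> (\<lambda>t. x\<^sub>0 + t *s v) -` U"
    by (meson openE)
  have "{t. norm t < r} \<subseteq> {t. poly p t = 0}"
    using r zero p by (force simp: subset_iff)
  then have "infinite {t. poly p t = 0}"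
    using infinite_near_zero[OF r(1)] finite_subset by blast
  then have "p = 0" using poly_roots_finite by blast
  then show "meval F x = 0" using p[of 1] by (simp add: v_def)
qed

lemma exists_mpoly_nonzero_point:
  assumes "F \<noteq> 0" obtains x where "meval F x \<noteq> 0"
  using mpoly_eq_zeroI assms by blast

lemma continuous_meval: "continuous_on S (meval F)"
proof (induction F rule: mpoly_induct)
  case (const c)
  then show ?case by simp
next
  case (var i)
  then show ?case by (simp add: continuous_on_component)
qed (simp_all add: continuous_on_add continuous_on_mult)

text \<open>The set where one factor does not vanish is open, and the other factor vanishes on it.\<close>

lemma mpoly_mult_eq_zero_fun:
  assumes "\<And>x. meval F x * meval G x = 0"
  shows "F = 0 \<or> G = 0"
proof (rule disjCI)
  assume "G \<noteq> 0"
  then obtain x where x: "meval G x \<noteq> 0" by (rule exists_mpoly_nonzero_point)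
  have "open {x. meval G x \<noteq> 0}"
    by (intro open_Collect_neq continuous_meval continuous_on_const)
  then show "F = 0"
    by (rule mpoly_eq_zero_on_open[of _ x]) (use x assms in auto)
qed


subsection \<open>Derivatives\<close>

lemma scalar_product_simps [simp]:
  "scalar_product h (x + y) = scalar_product h x + scalar_product h y"
  "scalar_product h (c *s x) = c * scalar_product h x"
  "scalar_product h (x - y) = scalar_product h x - scalar_product h y"
  "scalar_product h 0 = 0"
  "scalar_product 0 x = 0"
  for h :: "'a :: comm_ring_1 ^ 'n"
  by (simp_all add: scalar_product_def algebra_simps sum.distrib sum_subtractf sum_distrib_left)

lemma scalar_product_left:
  "scalar_product (g + h) x = scalar_product g x + scalar_product h x"
  "scalar_product (c *s h) x = c * scalar_product h x"
  for h :: "'a :: comm_ring_1 ^ 'n"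
  by (simp_all add: scalar_product_def algebra_simps sum.distrib sum_distrib_left)

lemma scalar_product_axis [simp]: "scalar_product h (axis i 1) = h $ i"
proof -
  have "scalar_product h (axis i 1) = (\<Sum>j\<in>UNIV. if j = i then h $ j else 0)"
    unfolding scalar_product_def by (intro sum.cong) (auto simp: axis_def)
  then show ?thesis by simp
qed

lemma has_derivative_along_line:
  "((\<lambda>t. x + t *s v) has_derivative (\<lambda>t. t *s v)) (at (t :: complex))" for v :: "complex ^ 'n::finite"
proof -
  have "linear (\<lambda>t :: complex. t *s v)"
    by (rule linearI) (auto simp: vec_eq_iff algebra_simps)
  then have "bounded_linear (\<lambda>t. t *s v)" by (rule linear_conv_bounded_linear[THEN iffD1])
  then show ?thesis
    by (auto intro!: derivative_eq_intros bounded_linear_imp_has_derivative)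
qed

text \<open>Existence of a complex linear derivative passes through sums and products; evaluating it on the
  coordinate directions identifies it with the vector of partial derivatives.\<close>

lemma has_derivative_meval:
  "(meval F has_derivative (\<lambda>v. scalar_product (gradient F x) v)) (at x)"
proof -
  have "\<exists>a. (meval F has_derivative (\<lambda>v. scalar_product a v)) (at x)"
  proof (induction F rule: mpoly_induct)
    case (const c)
    then show ?case by (intro exI[of _ 0]) simp
  next
    case (var i)
    have "((\<lambda>x. x $ i) has_derivative (\<lambda>v. v $ i)) (at x)"
      by (intro bounded_linear_imp_has_derivative bounded_linear_vec_nth)
    moreover have "v $ i = scalar_product (axis i 1) v" for v :: "complex ^ 'a"
      using scalar_product_axis[of v i] by (simp add: scalar_product_def mult.commute)
    moreover have "meval (mvar i) = (\<lambda>x. x $ i)" by auto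
    ultimately show ?case by auto
  next
    case (add F G)
    then obtain a b where "(meval F has_derivative (\<lambda>v. scalar_product a v)) (at x)"
      "(meval G has_derivative (\<lambda>v. scalar_product b v)) (at x)" by blast
    moreover have "scalar_product a v + scalar_product b v = scalar_product (a + b) v" for v
      by (simp add: scalar_product_def algebra_simps sum.distrib)
    moreover have "meval (F + G) = (\<lambda>x. meval F x + meval G x)" by auto
    ultimately show ?case by (metis (no_types, lifting) has_derivative_add has_derivative_eq_rhs ext)
  next
    case (mult F G)
    then obtain a b where ab: "(meval F has_derivative (\<lambda>v. scalar_product a v)) (at x)"
      "(meval G has_derivative (\<lambda>v. scalar_product b v)) (at x)" by blast
    have "meval F x * scalar_product b v + scalar_product a v * meval G x
        = scalar_product (meval F x *s b + meval G x *s a) v" for v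
      by (simp add: scalar_product_def algebra_simps sum.distrib sum_distrib_left)
    moreover have "meval (F * G) = (\<lambda>x. meval F x * meval G x)" by auto
    ultimately show ?case using has_derivative_mult[OF ab] by auto
  qed
  then obtain a where a: "(meval F has_derivative (\<lambda>v. scalar_product a v)) (at x)" by blast
  have "gradient F x $ i = a $ i" for i
  proof -
    have "(meval F has_derivative (\<lambda>v. scalar_product a v)) (at (x + 0 *s axis i 1))"
      using a by simp
    from diff_chain_at[OF has_derivative_along_line this]
    have "((\<lambda>c. meval F (x + c *s axis i 1)) has_derivative (\<lambda>c. a $ i * c)) (at 0)"
      by (simp add: o_def mult.commute)
    then have "((\<lambda>c. meval F (x + c *s axis i 1)) has_field_derivative a $ i) (at 0)"
      by (simp add: has_field_derivative_def)
    then show ?thesis by (simp add: gradient_def DERIV_imp_deriv)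
  qed
  then have "gradient F x = a" by (simp add: vec_eq_iff)
  with a show ?thesis by simp
qed

lemma gradient_unique:
  assumes "(meval F has_derivative (\<lambda>v. scalar_product a v)) (at x)"
  shows "gradient F x = a"
proof -
  have "(\<lambda>v. scalar_product (gradient F x) v) = (\<lambda>v. scalar_product a v)"
    using has_derivative_unique[OF has_derivative_meval assms] .
  then show ?thesis by (metis scalar_product_axis vec_eq_iff)
qed

lemma gradient_line_deriv:
  "((\<lambda>t. meval F (x + t *s v)) has_field_derivative scalar_product (gradient F x) v) (at 0)"
proof -
  have "(meval F has_derivative (\<lambda>v. scalar_product (gradient F x) v)) (at (x + 0 *s v))"
    using has_derivative_meval by simp
  from diff_chain_at[OF has_derivative_along_line this]
  show ?thesis by (simp add: o_def mult.commute[of _ "scalar_product (gradient F x) v"] has_field_derivative_def)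
qed

lemma gradient_mult [simp]: "gradient (F * G) x = meval F x *s gradient G x + meval G x *s gradient F x"
proof (rule gradient_unique)
  have "meval F x * scalar_product (gradient G x) v + scalar_product (gradient F x) v * meval G x
      = scalar_product (meval F x *s gradient G x + meval G x *s gradient F x) v" for v
    by (simp add: scalar_product_def algebra_simps sum.distrib sum_distrib_left)
  moreover have "meval (F * G) = (\<lambda>x. meval F x * meval G x)" by auto
  ultimately show "(meval (F * G) has_derivative
      (\<lambda>v. scalar_product (meval F x *s gradient G x + meval G x *s gradient F x) v)) (at x)"
    using has_derivative_mult[OF has_derivative_meval[of F x] has_derivative_meval[of G x]] by auto
qed

lemma gradient_add [simp]: "gradient (F + G) x = gradient F x + gradient G x"
proof (rule gradient_unique)
  have "scalar_product (gradient F x) v + scalar_product (gradient G x) v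
      = scalar_product (gradient F x + gradient G x) v" for v
    by (simp add: scalar_product_def algebra_simps sum.distrib)
  moreover have "meval (F + G) = (\<lambda>x. meval F x + meval G x)" by auto
  ultimately show "(meval (F + G) has_derivative
      (\<lambda>v. scalar_product (gradient F x + gradient G x) v)) (at x)"
    using has_derivative_add[OF has_derivative_meval[of F x] has_derivative_meval[of G x]] by auto
qed

lemma gradient_const [simp]: "gradient (mconst c) x = 0" for x :: "complex ^ 'n::finite"
proof (rule gradient_unique)
  have *: "meval (mconst c) = (\<lambda>x :: complex ^ 'n. c)"
    "scalar_product 0 = (\<lambda>x :: complex ^ 'n. 0)" by auto
  show "(meval (mconst c) has_derivative scalar_product 0) (at x)"
    unfolding * by (rule has_derivative_const)
qed

lemma gradient_var [simp]: "gradient (mvar i) x = axis i 1"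
proof (rule gradient_unique)
  have "((\<lambda>x. x $ i) has_derivative (\<lambda>v. v $ i)) (at x)"
    by (intro bounded_linear_imp_has_derivative bounded_linear_vec_nth)
  moreover have "v $ i = scalar_product (axis i 1) v" for v :: "complex ^ 'a"
    using scalar_product_axis[of v i] by (simp add: scalar_product_def mult.commute)
  moreover have "meval (mvar i) = (\<lambda>x. x $ i)" by auto
  ultimately show "(meval (mvar i) has_derivative scalar_product (axis i 1)) (at x)" by auto
qed

lemma gradient_minus [simp]: "gradient (- F) x = - gradient F x"
proof -
  have "- F = mconst (- 1) * F" by (rule mpoly_eqI) simp
  then show ?thesis by simp
qed

lemma gradient_diff [simp]: "gradient (F - G) x = gradient F x - gradient G x"
  using gradient_add[of F "- G" x] by simp

lemma gradient_power [simp]: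
  "gradient (F ^ k) x = (of_nat k * meval F x ^ (k - 1)) *s gradient F x"
proof (induction k)
  case 0
  have "mconst 1 = (1 :: 'a mpoly)" by (rule mpoly_eqI) simp
  then show ?case using gradient_const[of 1 x] by simp
next
  case (Suc k)
  then show ?case by (cases k) (simp_all add: vec_eq_iff algebra_simps)
qed


lemma gradient_sum [simp]: "gradient (\<Sum>a\<in>S. f a) x = (\<Sum>a\<in>S. gradient (f a) x)"
proof (induction S rule: infinite_finite_induct)
  case empty
  then show ?case using gradient_const[of 0 x] by (simp add: mconst_def)
next
  case (infinite A)
  then show ?case using gradient_const[of 0 x] by (simp add: mconst_def)
qed auto


subsection \<open>Homogeneous polynomials\<close>

lemma homogeneous_zero [simp]: "homogeneous d 0"
  by (simp add: homogeneous_def)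

lemma homogeneous_add: "homogeneous d F \<Longrightarrow> homogeneous d G \<Longrightarrow> homogeneous d (F + G)"
  using keys_add[of F G] unfolding homogeneous_def by blast

lemma homogeneous_minus: "homogeneous d F \<Longrightarrow> homogeneous d (- F)"
  by (simp add: homogeneous_def)

lemma homogeneous_diff: "homogeneous d F \<Longrightarrow> homogeneous d G \<Longrightarrow> homogeneous d (F - G)"
  using homogeneous_add[of d F "- G"] homogeneous_minus[of d G] by simp

lemma homogeneous_mult: "homogeneous d F \<Longrightarrow> homogeneous e G \<Longrightarrow> homogeneous (d + e) (F * G)"
  unfolding homogeneous_def using keys_mult[of F G]
  by (fastforce simp: lookup_add sum.distrib)

lemma homogeneous_const: "homogeneous 0 (mconst c)"
  by (simp add: homogeneous_def mconst_def)

lemma homogeneous_var: "homogeneous 1 (mvar i)"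
  by (simp add: homogeneous_def mvar_def lookup_single when_def)

lemma homogeneous_one: "homogeneous 0 1"
  using homogeneous_const[of 1] by (simp add: mconst_def)

lemma homogeneous_power: "homogeneous d F \<Longrightarrow> homogeneous (k * d) (F ^ k)"
  by (induction k) (auto simp: homogeneous_one intro: homogeneous_mult)

lemma homogeneous_prod:
  "(\<And>a. a \<in> S \<Longrightarrow> homogeneous (d a) (f a)) \<Longrightarrow> homogeneous (\<Sum>a\<in>S. d a) (\<Prod>a\<in>S. f a)"
  by (induction S rule: infinite_finite_induct) (auto simp: homogeneous_one intro: homogeneous_mult)

lemma homogeneous_sum:
  "(\<And>a. a \<in> S \<Longrightarrow> homogeneous d (f a)) \<Longrightarrow> homogeneous d (\<Sum>a\<in>S. f a)"
  by (induction S rule: infinite_finite_induct) (auto intro: homogeneous_add)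

lemma meval_homogeneous:
  assumes "homogeneous d F"
  shows "meval F (c *s x) = c ^ d * meval F x"
proof -
  have "Poly_Mapping.lookup F m * (\<Prod>i\<in>UNIV. (c * x $ i) ^ Poly_Mapping.lookup m i)
      = c ^ d * (Poly_Mapping.lookup F m * (\<Prod>i\<in>UNIV. (x $ i) ^ Poly_Mapping.lookup m i))"
    if "m \<in> Poly_Mapping.keys F" for m
  proof -
    have "(\<Prod>i\<in>UNIV. (c * x $ i) ^ Poly_Mapping.lookup m i)
        = c ^ (\<Sum>i\<in>UNIV. Poly_Mapping.lookup m i) * (\<Prod>i\<in>UNIV. (x $ i) ^ Poly_Mapping.lookup m i)"
      by (simp add: power_mult_distrib prod.distrib power_sum)
    with assms that show ?thesis by (simp add: homogeneous_def)
  qed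
  then show ?thesis unfolding meval_def sum_distrib_left by (intro sum.cong) auto
qed


subsection \<open>Substitution\<close>

text \<open>Composition with a polynomial map; \<open>P i\<close> is its component with index \<open>i\<close>.\<close>

definition msubst :: "('n::finite \<Rightarrow> 'm mpoly) \<Rightarrow> 'n mpoly \<Rightarrow> 'm mpoly" where
  "msubst P F = (\<Sum>m\<in>Poly_Mapping.keys F.
     mconst (Poly_Mapping.lookup F m) * (\<Prod>i\<in>UNIV. P i ^ Poly_Mapping.lookup m i))"

lemma meval_msubst [simp]: "meval (msubst P F) x = meval F (\<chi> i. meval (P i) x)"
  by (simp add: msubst_def) (simp add: meval_def)

lemma homogeneous_msubst:
  assumes "homogeneous d F" "\<And>i. homogeneous e (P i)"
  shows "homogeneous (d * e) (msubst P F)"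
  unfolding msubst_def
proof (rule homogeneous_sum)
  fix m assume "m \<in> Poly_Mapping.keys F"
  then have "d * e = 0 + (\<Sum>i\<in>UNIV. Poly_Mapping.lookup m i * e)"
    using assms(1) by (simp add: homogeneous_def sum_distrib_right[symmetric])
  then show "homogeneous (d * e)
      (mconst (Poly_Mapping.lookup F m) * (\<Prod>i\<in>UNIV. P i ^ Poly_Mapping.lookup m i))"
    using assms(2)
    by (metis (no_types, lifting) homogeneous_mult homogeneous_const homogeneous_prod homogeneous_power)
qed

lemma gradient_msubst:
  "scalar_product (gradient (msubst P F) x) v
    = scalar_product (gradient F (\<chi> i. meval (P i) x)) (\<chi> i. scalar_product (gradient (P i) x) v)"
proof (induction F rule: mpoly_induct)
  case (const c)
  have "msubst P (mconst c) = mconst c" by (rule mpoly_eqI) simp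
  then show ?case by simp
next
  case (var i)
  have "msubst P (mvar i) = P i" by (rule mpoly_eqI) simp
  moreover have "scalar_product (axis i 1) w = w $ i" for w :: "complex ^ 'b"
    using scalar_product_axis[of w i] by (simp add: scalar_product_def mult.commute)
  ultimately show ?case by simp
next
  case (add F G)
  have "msubst P (F + G) = msubst P F + msubst P G" by (rule mpoly_eqI) simp
  then show ?case using add by (simp add: scalar_product_left)
next
  case (mult F G)
  have "msubst P (F * G) = msubst P F * msubst P G" by (rule mpoly_eqI) simp
  then show ?case using mult by (simp add: scalar_product_left)
qed

definition lin_subst :: "complex ^ 'n ^ 'n \<Rightarrow> 'n::finite mpoly \<Rightarrow> 'n mpoly" where
  "lin_subst A F = msubst (\<lambda>i. \<Sum>j\<in>UNIV. mconst (A $ i $ j) * mvar j) F"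

lemma meval_lin_subst [simp]: "meval (lin_subst A F) x = meval F (A *v x)"
  by (simp add: lin_subst_def matrix_vector_mult_def)

lemma homogeneous_lin_subst: "homogeneous d F \<Longrightarrow> homogeneous d (lin_subst A F)"
  unfolding lin_subst_def
  using homogeneous_msubst[of d F 1 "\<lambda>i. \<Sum>j\<in>UNIV. mconst (A $ i $ j) * mvar j"]
    homogeneous_mult[OF homogeneous_const homogeneous_var]
  by (metis (no_types, lifting) add_0 homogeneous_sum mult.right_neutral)

lemma scalar_product_matrix:
  "scalar_product h (A *v x) = scalar_product (transpose A *v h) x" for A :: "'a::comm_ring_1 ^ 'n ^ 'm"
proof -
  have "scalar_product h (A *v x) = (\<Sum>i\<in>UNIV. \<Sum>j\<in>UNIV. h $ i * A $ i $ j * x $ j)"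
    by (simp add: scalar_product_def matrix_vector_mult_def sum_distrib_left mult.assoc)
  also have "\<dots> = (\<Sum>j\<in>UNIV. \<Sum>i\<in>UNIV. h $ i * A $ i $ j * x $ j)"
    by (rule sum.swap)
  finally show ?thesis
    by (simp add: scalar_product_def matrix_vector_mult_def transpose_def sum_distrib_left
        sum_distrib_right mult.commute)
qed

lemma gradient_lin_subst: "gradient (lin_subst A F) x = transpose A *v gradient F (A *v x)"
proof (rule gradient_unique)
  have "((\<lambda>x. A *v x) has_derivative (\<lambda>x. A *v x)) (at x)"
    by (intro bounded_linear_imp_has_derivative matrix_vector_mul_bounded_linear)
  from diff_chain_at[OF this has_derivative_meval]
  show "(meval (lin_subst A F) has_derivative scalar_product (transpose A *v gradient F (A *v x))) (at x)"
    by (simp add: o_def scalar_product_matrix del: transpose_matrix_vector flip: meval_lin_subst)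
qed


section \<open>Projective transformations\<close>

lemma pt_eq_range: "pt x = range (\<lambda>k. k *s x)"
  by (simp add: pt_def vec.span_singleton)

lemma in_pt_nonzero_iff: "y \<in> pt x - {0} \<longleftrightarrow> x \<noteq> 0 \<and> (\<exists>c. c \<noteq> 0 \<and> y = c *s x)"
  by (auto simp: pt_eq_range)

lemma self_in_pt: "x \<in> pt x"
  unfolding pt_eq_range by (metis rangeI vector_smult_lid)

lemma pt_smult: "c \<noteq> 0 \<Longrightarrow> pt (c *s x) = pt x"
proof -
  assume c: "c \<noteq> 0"
  have "k *s x = (k / c) *s (c *s x)" "k *s (c *s x) = (k * c) *s x" for k using c by simp_all
  then show ?thesis unfolding pt_eq_range by (intro subset_antisym image_subsetI) (metis rangeI)+
qed

lemma pt_eqD: "pt x = pt y \<Longrightarrow> y \<noteq> 0 \<Longrightarrow> \<exists>c. c \<noteq> 0 \<and> y = c *s x"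
  using self_in_pt[of y] in_pt_nonzero_iff[of y x] by auto

definition is_cone :: "(complex ^ 'n) set \<Rightarrow> bool" where
  "is_cone W \<longleftrightarrow> (\<forall>x\<in>W. \<forall>c. c \<noteq> 0 \<longrightarrow> c *s x \<in> W)"

lemma pt_in_projectivization_iff:
  "is_cone W \<Longrightarrow> x \<noteq> 0 \<Longrightarrow> pt x \<in> projectivization W \<longleftrightarrow> x \<in> W"
proof
  assume W: "is_cone W" "x \<noteq> 0" "pt x \<in> projectivization W"
  then obtain w where w: "pt w = pt x" "w \<in> W" by (auto simp: projectivization_def)
  from pt_eqD[OF w(1) W(2)] w(2) W(1) show "x \<in> W" by (auto simp: is_cone_def)
qed (auto simp: projectivization_def)

lemma is_cone_zero_set: "homogeneous d F \<Longrightarrow> is_cone {x. meval F x = 0}"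
  by (simp add: is_cone_def meval_homogeneous)

lemma pt_in_zero_locus_iff:
  "homogeneous d F \<Longrightarrow> x \<noteq> 0 \<Longrightarrow> pt x \<in> zero_locus F \<longleftrightarrow> meval F x = 0"
  unfolding zero_locus_def using pt_in_projectivization_iff[OF is_cone_zero_set] by auto

lemma is_cone_hyperplane: "is_cone {x. scalar_product h x = 0}"
  by (simp add: is_cone_def)

lemma pt_in_hyperplane_iff: "x \<noteq> 0 \<Longrightarrow> pt x \<in> hyperplane h \<longleftrightarrow> scalar_product h x = 0"
  unfolding hyperplane_def using pt_in_projectivization_iff[OF is_cone_hyperplane] by auto

abbreviation proj_map :: "complex ^ 'n ^ 'n \<Rightarrow> (complex ^ 'n::finite) set set \<Rightarrow> (complex ^ 'n) set set" where
  "proj_map A X \<equiv> (\<lambda>p. (\<lambda>x. A *v x) ` p) ` X"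

lemma image_pt: "(\<lambda>x. A *v x) ` pt x = pt (A *v x)"
  by (simp add: pt_eq_range image_image matrix_vector_mult_scaleR vector_scalar_commute)

lemma proj_map_mult: "proj_map A (proj_map B X) = proj_map (A ** B) X"
  by (simp add: image_image matrix_vector_mul_assoc)

lemma proj_map_id [simp]: "proj_map (mat 1) X = X"
  by simp

lemma inverse_matrixE:
  fixes A :: "complex ^ 'n ^ 'n"
  assumes "invertible A"
  obtains B where "A ** B = mat 1" "B ** A = mat 1" "invertible B"
  using assms by (auto simp: invertible_def)

lemma inverse_matrix_vector:
  "A ** B = mat 1 \<Longrightarrow> A *v (B *v x) = x" for A :: "complex ^ 'n ^ 'n"
  by (simp add: matrix_vector_mul_assoc)

lemma invertible_vector_eq_zero_iff: "invertible A \<Longrightarrow> A *v x = 0 \<longleftrightarrow> x = 0" for A :: "complex ^ 'n ^ 'n"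
  by (metis inverse_matrixE inverse_matrix_vector matrix_vector_mult_0_right)

lemma proj_map_projectivization:
  fixes A :: "complex ^ 'n::finite ^ 'n"
  assumes "invertible A"
  shows "proj_map A (projectivization W) = projectivization ((\<lambda>x. A *v x) ` W)"
proof -
  have *: "projectivization V = pt ` (V - {0})" for V :: "(complex ^ 'n) set"
    by (auto simp: projectivization_def)
  have "(\<lambda>x. A *v x) ` W - {0} = (\<lambda>x. A *v x) ` (W - {0})"
    using invertible_vector_eq_zero_iff[OF assms] by auto
  then show ?thesis unfolding * by (simp add: image_image image_pt)
qed

lemma image_matrix_Collect:
  fixes A B :: "complex ^ 'n ^ 'n"
  assumes "A ** B = mat 1" "B ** A = mat 1"
  shows "(\<lambda>x. A *v x) ` {x. Q (A *v x)} = {x :: complex ^ 'n. Q x}"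
proof (intro subset_antisym subsetI)
  fix y assume "y \<in> {x. Q x}"
  then have "A *v (B *v y) \<in> (\<lambda>x. A *v x) ` {x. Q (A *v x)}"
    using inverse_matrix_vector[OF assms(1), of y] by (intro imageI) simp
  then show "y \<in> (\<lambda>x. A *v x) ` {x. Q (A *v x)}"
    by (simp only: inverse_matrix_vector[OF assms(1)])
qed auto

lemma projectively_equivalentI: "invertible A \<Longrightarrow> Y = proj_map A X \<Longrightarrow> projectively_equivalent X Y"
  unfolding projectively_equivalent_def by blast

lemma projectively_equivalent_sym:
  assumes "projectively_equivalent X Y" shows "projectively_equivalent Y X"
proof -
  obtain A where A: "invertible A" "Y = proj_map A X"
    using assms unfolding projectively_equivalent_def by blast
  obtain B where B: "B ** A = mat 1" "invertible B" using A(1) by (rule inverse_matrixE)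
  show ?thesis
    by (rule projectively_equivalentI[OF B(2)]) (simp only: A(2) proj_map_mult B proj_map_id)
qed

lemma projectively_equivalent_trans:
  assumes "projectively_equivalent X Y" "projectively_equivalent Y Z"
  shows "projectively_equivalent X Z"
proof -
  obtain A B where "invertible A" "Y = proj_map A X" "invertible B" "Z = proj_map B Y"
    using assms unfolding projectively_equivalent_def by blast
  then show ?thesis
    by (intro projectively_equivalentI[of "B ** A"]) (simp_all only: invertible_mult proj_map_mult)
qed

lemma zero_locus_lin_subst:
  assumes "invertible A"
  shows "proj_map A (zero_locus (lin_subst A F)) = zero_locus F"
proof -
  obtain B where B: "A ** B = mat 1" "B ** A = mat 1" using assms by (rule inverse_matrixE)
  show ?thesis
    unfolding zero_locus_def proj_map_projectivization[OF assms]
    using image_matrix_Collect[OF B, of "\<lambda>x. meval F x = 0"] by simp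
qed

lemma transpose_invertible: "invertible A \<Longrightarrow> invertible (transpose A)" for A :: "complex ^ 'n ^ 'n"
  by (simp add: invertible_det_nz)

lemma singular_locus_lin_subst:
  assumes "invertible A"
  shows "proj_map A (singular_locus (lin_subst A F)) = singular_locus F"
proof -
  obtain B where B: "A ** B = mat 1" "B ** A = mat 1" using assms by (rule inverse_matrixE)
  show ?thesis
    unfolding singular_locus_def proj_map_projectivization[OF assms] gradient_lin_subst
      invertible_vector_eq_zero_iff[OF transpose_invertible[OF assms]] meval_lin_subst
    using image_matrix_Collect[OF B, of "\<lambda>x. meval F x = 0 \<and> gradient F x = 0"] by simp
qed

lemma lin_subst_inverse:
  assumes "A ** B = mat 1"
  shows "lin_subst B (lin_subst A F) = F"
  by (rule mpoly_eqI) (simp add: inverse_matrix_vector[OF assms])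

text \<open>The linear subspace whose projectivization is the tangent space.\<close>

definition tangent_vectors :: "(complex ^ 'n) set set \<Rightarrow> (complex ^ 'n) set \<Rightarrow> (complex ^ 'n::finite) set" where
  "tangent_vectors C p = {y. \<forall>F d. homogeneous d F \<and> C \<subseteq> zero_locus F \<longrightarrow>
           (\<forall>x\<in>p - {0}. scalar_product (gradient F x) y = 0)}"

lemma tangent_space_eq: "tangent_space C p = projectivization (tangent_vectors C p)"
  by (simp add: tangent_space_def tangent_vectors_def)

text \<open>Pulling back along \<open>A\<close> turns forms vanishing on the image of \<open>C\<close> into forms vanishing on \<open>C\<close>,
  and the chain rule relates their gradients.\<close>

lemma tangent_vectors_image:
  assumes "invertible A" "y \<in> tangent_vectors C p"
  shows "A *v y \<in> tangent_vectors (proj_map A C) ((\<lambda>x. A *v x) ` p)"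
  unfolding tangent_vectors_def
proof (intro CollectI allI impI ballI)
  fix F d x'
  assume "homogeneous d F \<and> proj_map A C \<subseteq> zero_locus F" and x': "x' \<in> (\<lambda>x. A *v x) ` p - {0}"
  then have F: "homogeneous d F" "proj_map A C \<subseteq> zero_locus F" by auto
  obtain x where x: "x \<in> p" "A *v x \<noteq> 0" "x' = A *v x" using x' by auto
  obtain B where B: "A ** B = mat 1" "B ** A = mat 1" "invertible B"
    using assms(1) by (rule inverse_matrixE)
  have "proj_map B (proj_map A C) \<subseteq> proj_map B (zero_locus F)"
    using F(2) by (rule image_mono)
  moreover have "zero_locus F = proj_map A (zero_locus (lin_subst A F))"
    using zero_locus_lin_subst[OF assms(1)] by simp
  ultimately have "C \<subseteq> zero_locus (lin_subst A F)"
    by (simp only: proj_map_mult B proj_map_id)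
  moreover have "homogeneous d (lin_subst A F)" using F(1) by (rule homogeneous_lin_subst)
  moreover have "x \<in> p - {0}" using x by auto
  ultimately have "scalar_product (gradient (lin_subst A F) x) y = 0"
    using assms(2) unfolding tangent_vectors_def by blast
  then show "scalar_product (gradient F x') (A *v y) = 0"
    unfolding x(3) by (simp add: gradient_lin_subst scalar_product_matrix del: transpose_matrix_vector)
qed

lemma tangent_space_proj_map:
  assumes "invertible A"
  shows "tangent_space (proj_map A C) ((\<lambda>x. A *v x) ` p) = proj_map A (tangent_space C p)"
proof -
  obtain B where B: "A ** B = mat 1" "B ** A = mat 1" "invertible B"
    using assms by (rule inverse_matrixE)
  have "y \<in> (\<lambda>x. A *v x) ` tangent_vectors C p"
    if "y \<in> tangent_vectors (proj_map A C) ((\<lambda>x. A *v x) ` p)" for y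
  proof -
    from tangent_vectors_image[OF B(3) that]
    have "B *v y \<in> tangent_vectors C p"
      by (simp add: proj_map_mult B image_image matrix_vector_mul_assoc)
    then show ?thesis using inverse_matrix_vector[OF B(1), of y] by (metis image_eqI)
  qed
  then have "tangent_vectors (proj_map A C) ((\<lambda>x. A *v x) ` p) = (\<lambda>x. A *v x) ` tangent_vectors C p"
    using tangent_vectors_image[OF assms] by blast
  then show ?thesis
    by (simp add: tangent_space_eq proj_map_projectivization[OF assms])
qed

lemma is_line_proj_map:
  assumes "invertible A" "is_line L"
  shows "is_line (proj_map A L)"
proof -
  obtain W where W: "vec.subspace W" "vec.dim W = 2" "L = projectivization W"
    using assms(2) by (auto simp: is_line_def)
  have lin: "Vector_Spaces.linear (*s) (*s) (\<lambda>x. A *v x)" by (rule matrix_vector_mul_linear_gen)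
  have "inj (\<lambda>x. A *v x)"
    using assms(1) by (metis inverse_matrixE inverse_matrix_vector injI)
  then have "vec.dim ((\<lambda>x. A *v x) ` W) = 2"
    using vec.dim_image_eq[OF lin, of W] W(2) by (metis inj_on_subset subset_UNIV)
  moreover have "vec.subspace ((\<lambda>x. A *v x) ` W)"
    using vec.subspace_image[OF W(1)] .
  ultimately show ?thesis
    unfolding is_line_def W(3) proj_map_projectivization[OF assms(1)] by blast
qed

lemma tangent_lines_proj_map:
  assumes "invertible A"
  shows "tangent_lines (proj_map A C) = proj_map A ` tangent_lines C"
proof -
  have sub: "proj_map A ` tangent_lines C \<subseteq> tangent_lines (proj_map A C)"
    if "invertible A" for A and C :: "(complex ^ 'a) set set"
    unfolding tangent_lines_def
    using is_line_proj_map[OF that] tangent_space_proj_map[OF that] by auto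
  obtain B where B: "A ** B = mat 1" "B ** A = mat 1" "invertible B"
    using assms by (rule inverse_matrixE)
  have "L \<in> proj_map A ` tangent_lines C" if "L \<in> tangent_lines (proj_map A C)" for L
  proof -
    have "proj_map B L \<in> tangent_lines (proj_map B (proj_map A C))"
      using sub[OF B(3)] that by blast
    then have "proj_map B L \<in> tangent_lines C" by (simp only: proj_map_mult B proj_map_id)
    moreover have "L = proj_map A (proj_map B L)" by (simp only: proj_map_mult B proj_map_id)
    ultimately show ?thesis by blast
  qed
  then show ?thesis using sub[OF assms] by blast
qed

lemma hyperplane_proj_map:
  assumes "invertible A"
  shows "proj_map A (hyperplane (transpose A *v h)) = hyperplane h"
proof -
  obtain B where B: "A ** B = mat 1" "B ** A = mat 1" using assms by (rule inverse_matrixE)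
  show ?thesis
    unfolding hyperplane_def proj_map_projectivization[OF assms] scalar_product_matrix[symmetric]
    using image_matrix_Collect[OF B, of "\<lambda>x. scalar_product h x = 0"] by simp
qed

text \<open>A linear change of the ambient space acts on the dual space by the inverse transpose.\<close>

lemma dual_surface_proj_map:
  assumes "invertible A"
  shows "dual_surface D = proj_map (transpose A) (dual_surface (proj_map A D))"
proof -
  obtain B where B: "A ** B = mat 1" "B ** A = mat 1" "invertible B"
    using assms by (rule inverse_matrixE)
  have T: "invertible (transpose A)" using assms by (rule transpose_invertible)
  have inj: "inj (proj_map A)"
    by (rule inj_on_inverseI[where g = "proj_map B"]) (simp only: proj_map_mult B proj_map_id)
  have sub: "L \<subseteq> hyperplane (transpose A *v h) \<longleftrightarrow> proj_map A L \<subseteq> hyperplane h" for h L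
    using inj_image_subset_iff[of "\<lambda>p. (\<lambda>x. A *v x) ` p" L "hyperplane (transpose A *v h)"]
      hyperplane_proj_map[OF assms, of h]
    by (metis (no_types, lifting) B(2) image_mono proj_map_id proj_map_mult)
  define R where "R h \<longleftrightarrow> (\<exists>L\<in>tangent_lines D. L \<subseteq> hyperplane h)" for h
  have R: "(\<exists>L\<in>tangent_lines (proj_map A D). L \<subseteq> hyperplane h) \<longleftrightarrow> R (transpose A *v h)" for h
    unfolding tangent_lines_proj_map[OF assms] R_def by (simp add: sub del: transpose_matrix_vector)
  have TB: "transpose A ** transpose B = mat 1" "transpose B ** transpose A = mat 1"
    by (simp_all add: matrix_transpose_mul[symmetric] B transpose_mat)
  have P: "dual_surface D = projectivization {h. R h}"
    "dual_surface (proj_map A D) = projectivization {h. R (transpose A *v h)}"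
    unfolding dual_surface_def projectivization_def R[symmetric] by (auto simp: R_def)
  show ?thesis
    unfolding P proj_map_projectivization[OF T] image_matrix_Collect[OF TB] by simp
qed

lemma for_general_hyperplane_subst:
  fixes B :: "complex ^ 'n ^ 'n::finite"
  assumes "for_general_hyperplane Q" "invertible B"
  shows "for_general_hyperplane (\<lambda>h. Q (B *v h))"
proof -
  obtain d G where G: "homogeneous d G" "G \<noteq> 0" "\<And>h. h \<noteq> 0 \<Longrightarrow> meval G h \<noteq> 0 \<Longrightarrow> Q h"
    using assms(1) unfolding for_general_hyperplane_def by blast
  obtain A where A: "B ** A = mat 1" using assms(2) by (rule inverse_matrixE)
  have "lin_subst B G \<noteq> 0"
    using lin_subst_inverse[OF A, of G] G(2) by (metis meval_lin_subst meval_zero mpoly_eq_zeroI)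
  then show ?thesis
    unfolding for_general_hyperplane_def
    using G homogeneous_lin_subst[OF G(1)] invertible_vector_eq_zero_iff[OF assms(2)]
    by (intro exI[of _ d] exI[of _ "lin_subst B G"]) auto
qed

text \<open>The inverse image under \<open>A\<close> of an affine chart of the plane \<open>h\<close> is a chart of its preimage, with
  the same local equation.\<close>

lemma plane_section_has_cusp_at_lin_subst:
  assumes "invertible A" "plane_section_has_cusp_at F h ((\<lambda>x. A *v x) ` p)"
  shows "plane_section_has_cusp_at (lin_subst A F) (transpose A *v h) p"
proof -
  obtain B where B: "A ** B = mat 1" "B ** A = mat 1" "invertible B"
    using assms(1) by (rule inverse_matrixE)
  obtain x y z where xyz: "(\<lambda>x. A *v x) ` p = pt x" "vec.span {x, y, z} = {v. scalar_product h v = 0}"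
    "cusp_at (\<lambda>w. meval F (x + w $ 1 *s y + w $ 2 *s z)) 0"
    using assms(2) unfolding plane_section_has_cusp_at_def by blast
  have "p = (\<lambda>x. B *v x) ` (\<lambda>x. A *v x) ` p"
    by (simp add: image_image inverse_matrix_vector[OF B(2)])
  then have "p = pt (B *v x)" by (simp add: xyz(1) image_pt)
  moreover have "vec.span {B *v x, B *v y, B *v z} = {v. scalar_product (transpose A *v h) v = 0}"
  proof -
    have lin: "Vector_Spaces.linear (*s) (*s) (\<lambda>x. B *v x)" by (rule matrix_vector_mul_linear_gen)
    have "vec.span {B *v x, B *v y, B *v z} = (\<lambda>x. B *v x) ` vec.span {x, y, z}"
      using vec.linear_span_image[OF lin, of "{x,y,z}"] by simp
    also have "\<dots> = {v. scalar_product (transpose A *v h) v = 0}"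
      unfolding xyz(2) using image_matrix_Collect[OF B(2,1), of "\<lambda>v. scalar_product (transpose A *v h) v = 0"]
      by (simp add: scalar_product_matrix[symmetric] inverse_matrix_vector[OF B(1)] del: transpose_matrix_vector)
    finally show ?thesis .
  qed
  moreover have "meval (lin_subst A F) (B *v x + a *s (B *v y) + b *s (B *v z)) = meval F (x + a *s y + b *s z)" for a b
    by (simp add: matrix_vector_right_distrib vector_scalar_commute inverse_matrix_vector[OF B(1)])
  ultimately show ?thesis
    unfolding plane_section_has_cusp_at_def using xyz(3) by (metis (no_types, lifting) ext)
qed

lemma cuspidal_curve_lin_subst:
  assumes A: "invertible A" and cusp: "cuspidal_curve F (proj_map A C)"
  shows "cuspidal_curve (lin_subst A F) C"
proof -
  obtain B where B: "A ** B = mat 1" "B ** A = mat 1" "invertible B"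
    using A by (rule inverse_matrixE)
  have "proj_map B (proj_map A C) \<subseteq> proj_map B (proj_map A (singular_locus (lin_subst A F)))"
    unfolding singular_locus_lin_subst[OF A] using cusp by (intro image_mono) (simp add: cuspidal_curve_def)
  then have sing: "C \<subseteq> singular_locus (lin_subst A F)"
    by (simp only: proj_map_mult B proj_map_id)
  have TB: "transpose A ** transpose B = mat 1"
    by (simp add: matrix_transpose_mul[symmetric] B transpose_mat)
  have "plane_section_has_cusp_at (lin_subst A F) h p"
    if "\<forall>p\<in>proj_map A C \<inter> hyperplane (transpose B *v h). plane_section_has_cusp_at F (transpose B *v h) p"
      "p \<in> C" "p \<in> hyperplane h" for h p
  proof -
    have h: "transpose A *v (transpose B *v h) = h" by (rule inverse_matrix_vector[OF TB])
    have "(\<lambda>x. A *v x) ` p \<in> proj_map A (hyperplane (transpose A *v (transpose B *v h)))"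
      using that(3) unfolding h by blast
    then have "(\<lambda>x. A *v x) ` p \<in> hyperplane (transpose B *v h)"
      by (simp only: hyperplane_proj_map[OF A])
    then have "plane_section_has_cusp_at F (transpose B *v h) ((\<lambda>x. A *v x) ` p)"
      using that(1,2) by blast
    from plane_section_has_cusp_at_lin_subst[OF A this] show ?thesis by (simp only: h)
  qed
  moreover have "for_general_hyperplane (\<lambda>h. \<forall>p\<in>proj_map A C \<inter> hyperplane (transpose B *v h).
      plane_section_has_cusp_at F (transpose B *v h) p)"
    using cusp for_general_hyperplane_subst[OF _ transpose_invertible[OF B(3)]]
    unfolding cuspidal_curve_def by blast
  ultimately have "for_general_hyperplane (\<lambda>h. \<forall>p\<in>C \<inter> hyperplane h. plane_section_has_cusp_at (lin_subst A F) h p)"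
    unfolding for_general_hyperplane_def by (meson IntE)
  with sing show ?thesis by (simp add: cuspidal_curve_def)
qed

lemma cuspidal_curve_lin_subst_iff:
  assumes A: "invertible A"
  shows "cuspidal_curve (lin_subst A F) C \<longleftrightarrow> cuspidal_curve F (proj_map A C)"
proof
  obtain B where B: "A ** B = mat 1" "B ** A = mat 1" "invertible B"
    using A by (rule inverse_matrixE)
  assume "cuspidal_curve (lin_subst A F) C"
  then have "cuspidal_curve (lin_subst A F) (proj_map B (proj_map A C))"
    by (simp only: proj_map_mult B proj_map_id)
  from cuspidal_curve_lin_subst[OF B(3) this] show "cuspidal_curve F (proj_map A C)"
    by (simp only: lin_subst_inverse[OF B(1)])
qed (rule cuspidal_curve_lin_subst[OF A])


section \<open>The standard twisted cubic and the discriminant form\<close>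

lemma vector_4 [simp]:
  "(vector [a, b, c, d] :: 'a::zero ^ 4) $ 1 = a"
  "(vector [a, b, c, d] :: 'a::zero ^ 4) $ 2 = b"
  "(vector [a, b, c, d] :: 'a::zero ^ 4) $ 3 = c"
  "(vector [a, b, c, d] :: 'a::zero ^ 4) $ 4 = d"
  by (simp_all add: vector_def)

lemma vec4_eq_iff: "x = y \<longleftrightarrow> x $ 1 = y $ 1 \<and> x $ 2 = y $ 2 \<and> x $ 3 = y $ 3 \<and> x $ 4 = y $ 4"
  for x y :: "'a ^ 4"
  by (simp add: vec_eq_iff forall_4)

lemma vec2_eq_iff: "x = y \<longleftrightarrow> x $ 1 = y $ 1 \<and> x $ 2 = y $ 2" for x y :: "'a ^ 2"
  by (simp add: vec_eq_iff forall_2)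

lemma scalar_product_4: "scalar_product h x = h $ 1 * x $ 1 + h $ 2 * x $ 2 + h $ 3 * x $ 3 + h $ 4 * x $ 4"
  for h :: "'a::semiring_1 ^ 4"
  by (simp add: scalar_product_def sum_4)

text \<open>A vector \<open>x\<close> is read as the binary cubic \<open>x\<^sub>1 X\<^sup>3 + 3 x\<^sub>2 X\<^sup>2 Y + 3 x\<^sub>3 X Y\<^sup>2 + x\<^sub>4 Y\<^sup>3\<close>. With these binomial
  factors \<open>nu s\<close> is the cube of the linear form \<open>s\<^sub>1 X + s\<^sub>2 Y\<close>, so that the cubic curve consists of
  the cubes.\<close>

definition nu :: "complex ^ 2 \<Rightarrow> complex ^ 4" where
  "nu s = vector [(s $ 1) ^ 3, (s $ 1) ^ 2 * s $ 2, s $ 1 * (s $ 2) ^ 2, (s $ 2) ^ 3]"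

definition std_cubic :: "(complex ^ 4) set set" where
  "std_cubic = {pt (nu s) | s. s \<noteq> 0}"

lemma twisted_cubic_iff: "twisted_cubic C \<longleftrightarrow> projectively_equivalent std_cubic C"
  by (simp add: twisted_cubic_def std_cubic_def nu_def)

lemma nu_eq_zero_iff: "nu s = 0 \<longleftrightarrow> s = 0"
  by (auto simp: nu_def vec4_eq_iff vec2_eq_iff)

lemma nu_smult: "nu (c *s s) = c ^ 3 *s nu s"
  by (simp add: nu_def vec4_eq_iff power_mult_distrib power2_eq_square power3_eq_cube)

lemma cube_root_exists:
  obtains k :: complex where "k ^ 3 = c"
proof (cases "c = 0")
  case True
  then show thesis using that[of 0] by simp
next
  case False
  have "exp (Ln c / 3) ^ 3 = exp (of_nat 3 * (Ln c / 3))"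
    by (rule exp_of_nat_mult[symmetric])
  then show thesis using that False by simp
qed

text \<open>The coefficients of the Hessian \<open>q\<^sub>0 X\<^sup>2 + q\<^sub>1 X Y + q\<^sub>2 Y\<^sup>2\<close> of the binary cubic. Their common zeros
  form the twisted cubic.\<close>

definition q0 :: "4 mpoly" where "q0 = mvar 1 * mvar 3 - mvar 2 ^ 2"
definition q1 :: "4 mpoly" where "q1 = mvar 1 * mvar 4 - mvar 2 * mvar 3"
definition q2 :: "4 mpoly" where "q2 = mvar 2 * mvar 4 - mvar 3 ^ 2"

text \<open>The discriminant of a binary cubic is, up to a constant factor, the discriminant of its Hessian.\<close>

definition disc_form :: "4 mpoly" where
  "disc_form = q1 ^ 2 - mconst 4 * q0 * q2"

lemma homogeneous_disc_quadrics: "homogeneous 2 q0" "homogeneous 2 q1" "homogeneous 2 q2"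
  unfolding q0_def q1_def q2_def
  using homogeneous_mult[OF homogeneous_var homogeneous_var, where 'a = 4]
    homogeneous_power[OF homogeneous_var, of 2, where 'a = 4]
  by (metis homogeneous_diff one_add_one mult.right_neutral)+

lemma homogeneous_disc_form: "homogeneous 4 disc_form"
proof -
  have "homogeneous (2 * 2) (q1 ^ 2)" "homogeneous (0 + 2 + 2) (mconst 4 * q0 * q2)"
    by (intro homogeneous_power homogeneous_mult homogeneous_const homogeneous_disc_quadrics)+
  then show ?thesis unfolding disc_form_def by (intro homogeneous_diff) (simp_all add: eval_nat_numeral)
qed

lemma meval_quadrics:
  "meval q0 x = x $ 1 * x $ 3 - (x $ 2) ^ 2"
  "meval q1 x = x $ 1 * x $ 4 - x $ 2 * x $ 3"
  "meval q2 x = x $ 2 * x $ 4 - (x $ 3) ^ 2"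
  by (simp_all add: q0_def q1_def q2_def)

lemma meval_disc_form: "meval disc_form x = (meval q1 x) ^ 2 - 4 * meval q0 x * meval q2 x"
  by (simp add: disc_form_def)

lemma scalar_product_axis_left [simp]: "scalar_product (axis i 1) w = w $ i" for w :: "'a::comm_ring_1 ^ 'n"
  using scalar_product_axis[of w i] by (simp add: scalar_product_def mult.commute)

lemma gradient_quadrics:
  "gradient q0 x = vector [x $ 3, - 2 * x $ 2, x $ 1, 0]"
  "gradient q1 x = vector [x $ 4, - x $ 3, - x $ 2, x $ 1]"
  "gradient q2 x = vector [0, x $ 4, - 2 * x $ 3, x $ 2]"
  by (simp_all add: q0_def q1_def q2_def vec4_eq_iff) (simp_all add: axis_def)

lemma gradient_disc_form:
  "gradient disc_form x = (2 * meval q1 x) *s gradient q1 x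
    - (4 * meval q0 x) *s gradient q2 x - (4 * meval q2 x) *s gradient q0 x"
  by (simp add: disc_form_def vec_eq_iff)

text \<open>The vanishing of the quadrics says that the entries of \<open>x\<close> are in geometric progression; a cube
  root makes the parametrization exact instead of projective.\<close>

lemma quadrics_vanish_imp_on_cubic:
  assumes "x \<noteq> 0" "meval q0 x = 0" "meval q1 x = 0" "meval q2 x = 0"
  obtains s where "s \<noteq> 0" "x = nu s"
proof (cases "x $ 1 = 0")
  case True
  obtain k where k: "k ^ 3 = x $ 4" by (rule cube_root_exists)
  have "x $ 2 = 0" "x $ 3 = 0" using True assms by (auto simp: meval_quadrics)
  with assms(1) True k have "vector [0, k] \<noteq> (0 :: complex ^ 2)" "x = nu (vector [0, k])"
    by (auto simp: vec4_eq_iff vec2_eq_iff nu_def)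
  then show thesis by (rule that)
next
  case False
  obtain k where k: "k ^ 3 = x $ 1" by (rule cube_root_exists)
  define r where "r = x $ 2 / x $ 1"
  have "x $ 2 = r * x $ 1" using False by (simp add: r_def)
  moreover from this assms(2) False have x3: "x $ 3 = r ^ 2 * x $ 1"
    by (simp add: meval_quadrics power2_eq_square)
  moreover from this \<open>x $ 2 = r * x $ 1\<close> assms(3) False have "x $ 4 = r ^ 3 * x $ 1"
    by (simp add: meval_quadrics power2_eq_square power3_eq_cube)
  ultimately have "x = nu (vector [k, r * k])"
    by (simp add: vec4_eq_iff nu_def k[symmetric] power2_eq_square power3_eq_cube)
  moreover have "vector [k, r * k] \<noteq> (0 :: complex ^ 2)" using k False by (auto simp: vec2_eq_iff)
  ultimately show thesis using that by blast
qed

lemma quadrics_vanish_on_cubic: "meval q0 (nu s) = 0" "meval q1 (nu s) = 0" "meval q2 (nu s) = 0"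
  by (simp_all add: meval_quadrics nu_def power2_eq_square power3_eq_cube)

text \<open>The partial derivatives are linear in the quadrics, with coefficients linear in \<open>x\<close>. Eliminating
  shows that the quadrics vanish wherever all four partial derivatives do.\<close>

lemma disc_form_critical_imp_quadrics_vanish:
  assumes "gradient disc_form x = 0"
  shows "meval q0 x = 0 \<and> meval q1 x = 0 \<and> meval q2 x = 0"
proof -
  define a b c d where "a = x $ 1" and "b = x $ 2" and "c = x $ 3" and "d = x $ 4"
  define p q r where "p = meval q0 x" and "q = meval q1 x" and "r = meval q2 x"
  have p: "p = a * c - b ^ 2" and q: "q = a * d - b * c" and r: "r = b * d - c ^ 2"
    by (simp_all add: p_def q_def r_def a_def b_def c_def d_def meval_quadrics)
  have e: "q * d = 2 * r * c" "q * c = 4 * r * b - 2 * p * d" "q * b = 4 * p * c - 2 * r * a" "q * a = 2 * p * b"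
    using assms
    by (simp_all add: gradient_disc_form vec4_eq_iff gradient_quadrics
        flip: a_def b_def c_def d_def p_def q_def r_def) (algebra+)
  have "p = 0 \<and> q = 0 \<and> r = 0"
  proof (cases "a = 0")
    case True
    with e(4) p have "b = 0" by auto
    with True p q r e(1) show ?thesis by auto
  next
    case False
    have "p = 0"
    proof (rule ccontr)
      assume "p \<noteq> 0"
      have "q ^ 2 = 4 * p * r" using e p q r by algebra
      then have "p * (a ^ 2 * r) = p * (p * b ^ 2)" using e(4) by algebra
      with \<open>p \<noteq> 0\<close> have "a ^ 2 * r = p * b ^ 2" by simp
      then have "4 * p * (b ^ 2 - a * c) = 0" using e by algebra
      with \<open>p \<noteq> 0\<close> p show False by algebra
    qed
    with e(4) False have "q = 0" by simp
    with e(3) \<open>p = 0\<close> False have "r = 0" by simp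
    with \<open>p = 0\<close> \<open>q = 0\<close> show ?thesis by simp
  qed
  then show ?thesis by (simp add: p_def q_def r_def)
qed

lemma singular_locus_disc_form: "singular_locus disc_form = std_cubic"
proof -
  have "x \<noteq> 0 \<and> meval disc_form x = 0 \<and> gradient disc_form x = 0 \<longleftrightarrow> (\<exists>s. s \<noteq> 0 \<and> x = nu s)" for x
  proof
    assume "x \<noteq> 0 \<and> meval disc_form x = 0 \<and> gradient disc_form x = 0"
    then show "\<exists>s. s \<noteq> 0 \<and> x = nu s"
      using quadrics_vanish_imp_on_cubic disc_form_critical_imp_quadrics_vanish by metis
  next
    assume "\<exists>s. s \<noteq> 0 \<and> x = nu s"
    then show "x \<noteq> 0 \<and> meval disc_form x = 0 \<and> gradient disc_form x = 0"
      by (auto simp: nu_eq_zero_iff meval_disc_form gradient_disc_form quadrics_vanish_on_cubic)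
  qed
  then have "{pt x | x. x \<noteq> 0 \<and> meval disc_form x = 0 \<and> gradient disc_form x = 0}
      = {pt x | x. \<exists>s. s \<noteq> 0 \<and> x = nu s}" by (simp only:)
  moreover have "\<dots> = std_cubic" unfolding std_cubic_def by auto
  ultimately show ?thesis
    by (simp add: singular_locus_def projectivization_def conj_ac)
qed


section \<open>Tangent lines and double roots\<close>

text \<open>The binary cubics divisible by \<open>(s\<^sub>1 X + s\<^sub>2 Y)\<^sup>2\<close>: both partial derivatives of the cubic vanish
  at \<open>(-s\<^sub>2, s\<^sub>1)\<close>. This plane lies over the tangent line at \<open>nu s\<close>.\<close>

definition tangent_plane :: "complex ^ 2 \<Rightarrow> (complex ^ 4) set" where
  "tangent_plane s = {x. x $ 1 * (s $ 2) ^ 2 - 2 * x $ 2 * s $ 1 * s $ 2 + x $ 3 * (s $ 1) ^ 2 = 0 \<and>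
     x $ 2 * (s $ 2) ^ 2 - 2 * x $ 3 * s $ 1 * s $ 2 + x $ 4 * (s $ 1) ^ 2 = 0}"

text \<open>The derivative of \<^const>\<open>nu\<close> at \<open>s\<close> in the direction \<open>m\<close>, which is the cubic
  \<open>3 (s\<^sub>1 X + s\<^sub>2 Y)\<^sup>2 (m\<^sub>1 X + m\<^sub>2 Y)\<close>.\<close>

definition dnu :: "complex ^ 2 \<Rightarrow> complex ^ 2 \<Rightarrow> complex ^ 4" where
  "dnu s m = vector [3 * (s $ 1) ^ 2 * m $ 1, 2 * s $ 1 * s $ 2 * m $ 1 + (s $ 1) ^ 2 * m $ 2,
     (s $ 2) ^ 2 * m $ 1 + 2 * s $ 1 * s $ 2 * m $ 2, 3 * (s $ 2) ^ 2 * m $ 2]"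

lemma dnu_in_tangent_plane: "dnu s m \<in> tangent_plane s"
  by (simp add: tangent_plane_def dnu_def algebra_simps power2_eq_square)

lemma tangent_planeE:
  assumes "x \<in> tangent_plane s" "s \<noteq> 0"
  obtains m where "x = dnu s m"
proof (cases "s $ 1 = 0")
  case True
  with assms have s2: "s $ 2 \<noteq> 0" by (auto simp: vec2_eq_iff)
  with True assms have "x $ 1 = 0" "x $ 2 = 0" by (auto simp: tangent_plane_def)
  then have "x = dnu s (vector [x $ 3 / (s $ 2) ^ 2, x $ 4 / (3 * (s $ 2) ^ 2)])"
    using True s2 by (simp add: vec4_eq_iff dnu_def)
  then show thesis by (rule that)
next
  case False
  define m where "m = x $ 1 / (3 * (s $ 1) ^ 2)"
  define n where "n = (x $ 2 - 2 * s $ 1 * s $ 2 * m) / (s $ 1) ^ 2"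
  have m: "x $ 1 = 3 * (s $ 1) ^ 2 * m" using False by (simp add: m_def)
  have n: "x $ 2 = 2 * s $ 1 * s $ 2 * m + (s $ 1) ^ 2 * n" using False by (simp add: n_def)
  have "(s $ 1) ^ 2 * x $ 3 = (s $ 1) ^ 2 * ((s $ 2) ^ 2 * m + 2 * s $ 1 * s $ 2 * n)"
    using assms(1) m n by (simp add: tangent_plane_def) algebra
  then have x3: "x $ 3 = (s $ 2) ^ 2 * m + 2 * s $ 1 * s $ 2 * n" using False by simp
  have "(s $ 1) ^ 2 * x $ 4 = (s $ 1) ^ 2 * (3 * (s $ 2) ^ 2 * n)"
    using assms(1) n x3 by (simp add: tangent_plane_def) algebra
  then have "x $ 4 = 3 * (s $ 2) ^ 2 * n" using False by simp
  with m n x3 have "x = dnu s (vector [m, n])" by (simp add: vec4_eq_iff dnu_def)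
  then show thesis by (rule that)
qed

lemma tangent_plane_smult: "c \<noteq> 0 \<Longrightarrow> tangent_plane (c *s s) = tangent_plane s"
proof -
  assume c: "c \<noteq> 0"
  have "x * (c * v) ^ 2 - 2 * y * (c * u) * (c * v) + z * (c * u) ^ 2
      = c ^ 2 * (x * v ^ 2 - 2 * y * u * v + z * u ^ 2)" for x y z u v :: complex
    by (simp add: algebra_simps power2_eq_square)
  with c show ?thesis unfolding tangent_plane_def by simp
qed

text \<open>Differentiate the identity \<open>F (nu s) = 0\<close> in \<open>s\<close>.\<close>

lemma gradient_perp_dnu:
  assumes "std_cubic \<subseteq> zero_locus F" "homogeneous d F"
  shows "scalar_product (gradient F (nu s)) (dnu s m) = 0"
proof -
  define P :: "4 \<Rightarrow> 2 mpoly" where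
    "P i = (vector [mvar 1 ^ 3, mvar 1 ^ 2 * mvar 2, mvar 1 * mvar 2 ^ 2, mvar 2 ^ 3] :: 2 mpoly ^ 4) $ i" for i
  have P: "(\<chi> i. meval (P i) s) = nu s" for s
    by (simp add: P_def vec4_eq_iff nu_def)
  have "msubst P F = 0"
  proof (rule mpoly_eq_zero_on_open[of "- {0}" 1])
    fix s :: "complex ^ 2" assume "s \<in> - {0}"
    then have "pt (nu s) \<in> std_cubic" "nu s \<noteq> 0" by (auto simp: std_cubic_def nu_eq_zero_iff)
    then show "meval (msubst P F) s = 0"
      using assms pt_in_zero_locus_iff[OF assms(2)] by (auto simp: P)
  qed (auto simp: vec_eq_iff)
  then have "gradient (msubst P F) s = 0"
    using gradient_const[of 0 s] by (simp add: mconst_def)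
  then have "scalar_product (gradient F (nu s)) (\<chi> i. scalar_product (gradient (P i) s) m) = 0"
    using gradient_msubst[of P F s m] by (simp add: P)
  moreover have "(\<chi> i. scalar_product (gradient (P i) s) m) = dnu s m"
    by (simp add: P_def vec4_eq_iff dnu_def scalar_product_def sum_2 axis_def algebra_simps)
  ultimately show ?thesis by simp
qed

text \<open>Every form vanishing on the cubic has a gradient perpendicular to the velocity vectors, and the
  differentials of the three quadrics already cut out the plane spanned by these.\<close>

lemma tangent_vectors_std_cubic:
  assumes "s \<noteq> 0"
  shows "tangent_vectors std_cubic (pt (nu s)) = tangent_plane s"
proof (intro subset_antisym subsetI)
  fix y assume y: "y \<in> tangent_vectors std_cubic (pt (nu s))"
  have "scalar_product (gradient q (nu s)) y = 0"
    if "homogeneous 2 q" "\<And>s. meval q (nu s) = 0" for q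
  proof -
    have "std_cubic \<subseteq> zero_locus q"
      using that by (auto simp: std_cubic_def pt_in_zero_locus_iff[OF that(1)] nu_eq_zero_iff)
    with y that(1) show ?thesis
      using assms self_in_pt[of "nu s"] nu_eq_zero_iff unfolding tangent_vectors_def by blast
  qed
  from this[OF homogeneous_disc_quadrics(1) quadrics_vanish_on_cubic(1)]
    this[OF homogeneous_disc_quadrics(2) quadrics_vanish_on_cubic(2)]
    this[OF homogeneous_disc_quadrics(3) quadrics_vanish_on_cubic(3)]
  have e: "s $ 1 * (s $ 2) ^ 2 * y $ 1 - 2 * ((s $ 1) ^ 2 * s $ 2) * y $ 2 + (s $ 1) ^ 3 * y $ 3 = 0"
    "(s $ 2) ^ 3 * y $ 1 - s $ 1 * (s $ 2) ^ 2 * y $ 2 - (s $ 1) ^ 2 * s $ 2 * y $ 3 + (s $ 1) ^ 3 * y $ 4 = 0"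
    "(s $ 2) ^ 3 * y $ 2 - 2 * (s $ 1 * (s $ 2) ^ 2) * y $ 3 + (s $ 1) ^ 2 * s $ 2 * y $ 4 = 0"
    by (simp_all add: gradient_quadrics scalar_product_4 nu_def)
  define \<phi> where "\<phi> = y $ 1 * (s $ 2) ^ 2 - 2 * y $ 2 * s $ 1 * s $ 2 + y $ 3 * (s $ 1) ^ 2"
  define \<psi> where "\<psi> = y $ 2 * (s $ 2) ^ 2 - 2 * y $ 3 * s $ 1 * s $ 2 + y $ 4 * (s $ 1) ^ 2"
  have "s $ 1 * \<phi> = 0" "s $ 1 * \<psi> + s $ 2 * \<phi> = 0" "s $ 2 * \<psi> = 0"
    using e unfolding \<phi>_def \<psi>_def by algebra+
  moreover have "s $ 1 \<noteq> 0 \<or> s $ 2 \<noteq> 0" using assms by (auto simp: vec2_eq_iff)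
  ultimately have "\<phi> = 0 \<and> \<psi> = 0" by auto
  then show "y \<in> tangent_plane s" by (simp add: tangent_plane_def \<phi>_def \<psi>_def)
next
  fix y assume y: "y \<in> tangent_plane s"
  show "y \<in> tangent_vectors std_cubic (pt (nu s))"
    unfolding tangent_vectors_def
  proof (intro CollectI allI impI ballI)
    fix F d x assume F: "homogeneous d F \<and> std_cubic \<subseteq> zero_locus F" and x: "x \<in> pt (nu s) - {0}"
    obtain c where c: "c \<noteq> 0" "x = c *s nu s"
      using in_pt_nonzero_iff[THEN iffD1, OF x] by auto
    obtain k where k: "k ^ 3 = c" by (rule cube_root_exists)
    have x_eq: "x = nu (k *s s)" using c k by (simp add: nu_smult)
    have "k \<noteq> 0" using k c by auto
    then have "y \<in> tangent_plane (k *s s)" "k *s s \<noteq> 0" using y assms by (simp_all add: tangent_plane_smult)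
    then obtain m where "y = dnu (k *s s) m" by (rule tangent_planeE)
    with F show "scalar_product (gradient F x) y = 0"
      using gradient_perp_dnu by (auto simp: x_eq)
  qed
qed

lemma is_line_tangent_plane:
  assumes "s \<noteq> 0"
  shows "is_line (projectivization (tangent_plane s))"
proof -
  define e f where "e = dnu s (vector [1, 0])" and "f = dnu s (vector [0, 1])"
  have comb: "dnu s m = m $ 1 *s e + m $ 2 *s f" for m
    by (simp add: dnu_def e_def f_def vec4_eq_iff algebra_simps)
  have "vec.span {e, f} = tangent_plane s"
  proof (intro subset_antisym subsetI)
    fix x assume "x \<in> vec.span {e, f}"
    then obtain a b where "x = a *s e + b *s f"
      by (auto simp: vec.span_insert vec.span_singleton algebra_simps)
    then have "x = dnu s (vector [a, b])" by (simp add: comb)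
    then show "x \<in> tangent_plane s" by (simp add: dnu_in_tangent_plane)
  next
    fix x assume "x \<in> tangent_plane s"
    then obtain m where "x = dnu s m" using assms by (rule tangent_planeE)
    then have "x = m $ 1 *s e + m $ 2 *s f" by (simp only: comb)
    then show "x \<in> vec.span {e, f}"
      by (simp add: vec.span_add vec.span_scale vec.span_base)
  qed
  moreover have "vec.subspace (vec.span {e, f})" by (rule vec.subspace_span)
  moreover have "vec.dim (vec.span {e, f}) = 2"
  proof -
    have f0: "f \<noteq> 0" using assms by (auto simp: f_def dnu_def vec4_eq_iff vec2_eq_iff)
    have ne: "e \<noteq> k *s f" for k
      using assms by (auto simp: e_def f_def dnu_def vec4_eq_iff vec2_eq_iff)
    have "vec.independent {f}" using f0 by simp
    moreover have "e \<notin> vec.span {f}" using ne by (auto simp: vec.span_singleton)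
    ultimately have "vec.independent {e, f}" by (simp add: vec.independent_insert)
    moreover have "card {e, f} = 2" using ne[of 1] by simp
    ultimately show ?thesis using vec.dim_eq_card_independent[of "{e, f}"] by (simp add: vec.dim_span)
  qed
  ultimately show ?thesis unfolding is_line_def by metis
qed

lemma tangent_lines_std_cubic:
  "tangent_lines std_cubic = {projectivization (tangent_plane s) | s. s \<noteq> 0}"
proof (intro subset_antisym subsetI)
  fix L assume "L \<in> tangent_lines std_cubic"
  then obtain s where "s \<noteq> 0" "L = tangent_space std_cubic (pt (nu s))"
    by (auto simp: tangent_lines_def) (auto simp: std_cubic_def)
  then show "L \<in> {projectivization (tangent_plane s) | s. s \<noteq> 0}"
    using tangent_vectors_std_cubic by (auto simp: tangent_space_eq)
next
  fix L assume "L \<in> {projectivization (tangent_plane s) | s. s \<noteq> 0}"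
  then obtain s where s: "s \<noteq> 0" "L = projectivization (tangent_plane s)" by blast
  then have "pt (nu s) \<in> std_cubic" "L = tangent_space std_cubic (pt (nu s))"
    unfolding tangent_space_eq tangent_vectors_std_cubic[OF s(1)] by (auto simp: std_cubic_def)
  with s is_line_tangent_plane show "L \<in> tangent_lines std_cubic"
    unfolding tangent_lines_def by blast
qed

text \<open>The discriminant vanishes exactly on the cubics with a repeated linear factor, that is, on the
  union of the tangent lines.\<close>

lemma disc_form_zero_iff:
  "meval disc_form x = 0 \<longleftrightarrow> (\<exists>s. s \<noteq> 0 \<and> x \<in> tangent_plane s)"
proof
  define p q r where "p = meval q0 x" and "q = meval q1 x" and "r = meval q2 x"
  define a b c d where "a = x $ 1" and "b = x $ 2" and "c = x $ 3" and "d = x $ 4"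
  have defs: "p = a * c - b ^ 2" "q = a * d - b * c" "r = b * d - c ^ 2"
    by (simp_all add: p_def q_def r_def a_def b_def c_def d_def meval_quadrics)
  assume "meval disc_form x = 0"
  then have qq: "q ^ 2 = 4 * p * r" by (simp add: p_def q_def r_def meval_disc_form)
  consider "p \<noteq> 0" | "p = 0" "r \<noteq> 0" | "p = 0" "r = 0" by blast
  then show "\<exists>s. s \<noteq> 0 \<and> x \<in> tangent_plane s"
  proof cases
    case 1
    \<comment> \<open>The Hessian is a multiple of the square of \<open>2 p X + q Y\<close>, which is the repeated factor of the cubic.\<close>
    have "a * q ^ 2 - 2 * b * (2 * p) * q + c * (2 * p) ^ 2 = 0"
      "b * q ^ 2 - 2 * c * (2 * p) * q + d * (2 * p) ^ 2 = 0"
      unfolding qq using defs by algebra+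
    then show ?thesis using 1 unfolding a_def b_def c_def d_def
      by (intro exI[of _ "vector [2 * p, q] :: complex ^ 2"]) (simp add: tangent_plane_def vec2_eq_iff)
  next
    case 2
    have "q = 0" using qq 2 by simp
    then have "a * r = 0" "b * r = 0" using 2 defs by algebra+
    with 2 have "x $ 1 = 0" "x $ 2 = 0" by (auto simp: a_def b_def)
    then show ?thesis
      by (intro exI[of _ "vector [0, 1] :: complex ^ 2"]) (simp add: tangent_plane_def vec2_eq_iff)
  next
    case 3
    then have "q = 0" using qq by simp
    show ?thesis
    proof (cases "x = 0")
      case True
      then show ?thesis by (intro exI[of _ "vector [0, 1] :: complex ^ 2"]) (simp add: tangent_plane_def vec2_eq_iff)
    next
      case False
      then obtain s where "s \<noteq> 0" "x = nu s"
        using quadrics_vanish_imp_on_cubic 3 \<open>q = 0\<close> unfolding p_def q_def r_def by metis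
      then show ?thesis
        by (intro exI[of _ s]) (simp add: tangent_plane_def nu_def power2_eq_square power3_eq_cube)
    qed
  qed
next
  assume "\<exists>s. s \<noteq> 0 \<and> x \<in> tangent_plane s"
  then obtain s m where "x = dnu s m" using tangent_planeE by blast
  moreover have "meval disc_form (dnu s m) = 0"
    by (simp add: meval_disc_form meval_quadrics dnu_def) algebra
  ultimately show "meval disc_form x = 0" by simp
qed

lemma union_tangent_lines_std_cubic: "\<Union> (tangent_lines std_cubic) = zero_locus disc_form"
  unfolding tangent_lines_std_cubic zero_locus_def disc_form_zero_iff projectivization_def by blast

text \<open>The two partial derivatives of the binary cubic with coefficients \<open>a\<close>, here taken without binomial
  factors, vanish at \<open>s\<close>.\<close>

definition double_root :: "complex ^ 4 \<Rightarrow> complex ^ 2 \<Rightarrow> bool" where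
  "double_root a s \<longleftrightarrow> 3 * a $ 1 * (s $ 1) ^ 2 + 2 * a $ 2 * s $ 1 * s $ 2 + a $ 3 * (s $ 2) ^ 2 = 0 \<and>
     a $ 2 * (s $ 1) ^ 2 + 2 * a $ 3 * s $ 1 * s $ 2 + 3 * a $ 4 * (s $ 2) ^ 2 = 0"

text \<open>Passes from the coefficients with binomial factors to those without.\<close>

definition binomial_scaling :: "complex ^ 4 ^ 4" where
  "binomial_scaling = (\<chi> i j. if i = j then (vector [1, 3, 3, 1] :: complex ^ 4) $ i else 0)"

lemma binomial_scaling_mult:
  "binomial_scaling *v x = vector [x $ 1, 3 * x $ 2, 3 * x $ 3, x $ 4]"
  by (simp add: vec4_eq_iff binomial_scaling_def matrix_vector_mult_def sum_4)

lemma invertible_binomial_scaling: "invertible binomial_scaling"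
proof -
  define B :: "complex ^ 4 ^ 4" where
    "B = (\<chi> i j. if i = j then (vector [1, 1 / 3, 1 / 3, 1] :: complex ^ 4) $ i else 0)"
  have "binomial_scaling ** B = mat 1" "B ** binomial_scaling = mat 1"
    by (simp_all add: vec_eq_iff forall_4 B_def binomial_scaling_def matrix_matrix_mult_def sum_4 mat_def)
  then show ?thesis unfolding invertible_def by blast
qed

lemma disc_form_zero_iff_double_root:
  "meval disc_form x = 0 \<longleftrightarrow> (\<exists>s. s \<noteq> 0 \<and> double_root (binomial_scaling *v x) s)"
proof -
  have swap: "double_root (binomial_scaling *v x) s \<longleftrightarrow> x \<in> tangent_plane (vector [- s $ 2, s $ 1])" for s
  proof -
    have "3 * a * u + 2 * (3 * b) * v * w + 3 * c * t = 3 * (a * u + 2 * b * v * w + c * t)"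
      for a b c u v w t :: complex by simp
    then show ?thesis
      by (simp add: double_root_def tangent_plane_def binomial_scaling_mult algebra_simps) algebra
  qed
  have "\<exists>s :: complex ^ 2. s \<noteq> 0 \<and> t = vector [- s $ 2, s $ 1]" if "t \<noteq> 0" for t :: "complex ^ 2"
    using that by (intro exI[of _ "vector [t $ 2, - t $ 1] :: complex ^ 2"]) (auto simp: vec2_eq_iff)
  moreover have "vector [- s $ 2, s $ 1] \<noteq> (0 :: complex ^ 2)" if "s \<noteq> 0" for s :: "complex ^ 2"
    using that by (auto simp: vec2_eq_iff)
  ultimately show ?thesis unfolding disc_form_zero_iff swap by metis
qed

lemma double_root_locus: "projectivization {a. \<exists>s. s \<noteq> 0 \<and> double_root a s} = proj_map binomial_scaling (zero_locus disc_form)"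
proof -
  obtain B where B: "binomial_scaling ** B = mat 1" "B ** binomial_scaling = mat 1"
    using invertible_binomial_scaling by (rule inverse_matrixE)
  show ?thesis
    unfolding zero_locus_def proj_map_projectivization[OF invertible_binomial_scaling]
      disc_form_zero_iff_double_root
    using image_matrix_Collect[OF B, of "\<lambda>a. \<exists>s. s \<noteq> 0 \<and> double_root a s"] by simp
qed

text \<open>As \<open>scalar_product h (nu s)\<close> is the binary cubic with coefficients \<open>h\<close> evaluated at \<open>s\<close>, the plane
  \<open>h\<close> contains the tangent line at \<open>nu s\<close> iff this cubic has a double root at \<open>s\<close>. Hence the dual
  surface and the discriminant surface coincide.\<close>

lemma dual_surface_std_cubic: "dual_surface std_cubic = proj_map binomial_scaling (zero_locus disc_form)"
proof -
  have "projectivization (tangent_plane s) \<subseteq> hyperplane h \<longleftrightarrow> double_root h s" if "s \<noteq> 0" for s h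
  proof -
    have "projectivization (tangent_plane s) \<subseteq> hyperplane h \<longleftrightarrow> (\<forall>x\<in>tangent_plane s. scalar_product h x = 0)"
    proof
      assume L: "projectivization (tangent_plane s) \<subseteq> hyperplane h"
      show "\<forall>x\<in>tangent_plane s. scalar_product h x = 0"
      proof
        fix x assume x: "x \<in> tangent_plane s"
        show "scalar_product h x = 0"
        proof (cases "x = 0")
          case False
          with x have "pt x \<in> projectivization (tangent_plane s)" by (auto simp: projectivization_def)
          with L False show ?thesis using pt_in_hyperplane_iff by blast
        qed simp
      qed
    qed (auto simp: hyperplane_def projectivization_def)
    also have "\<dots> \<longleftrightarrow> (\<forall>m. scalar_product h (dnu s m) = 0)"
      using tangent_planeE[OF _ that] dnu_in_tangent_plane by blast
    also have "\<dots> \<longleftrightarrow> double_root h s"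
    proof
      assume "\<forall>m. scalar_product h (dnu s m) = 0"
      then have "scalar_product h (dnu s (vector [1, 0])) = 0" "scalar_product h (dnu s (vector [0, 1])) = 0"
        by blast+
      then show "double_root h s" by (simp add: double_root_def scalar_product_4 dnu_def algebra_simps)
    next
      assume d: "double_root h s"
      show "\<forall>m. scalar_product h (dnu s m) = 0"
      proof
        fix m
        show "scalar_product h (dnu s m) = 0"
          using d by (simp add: double_root_def scalar_product_4 dnu_def) algebra
      qed
    qed
    finally show ?thesis .
  qed
  then have "(\<exists>L\<in>tangent_lines std_cubic. L \<subseteq> hyperplane h) \<longleftrightarrow> (\<exists>s. s \<noteq> 0 \<and> double_root h s)" for h
    unfolding tangent_lines_std_cubic by auto
  then have "dual_surface std_cubic = projectivization {a. \<exists>s. s \<noteq> 0 \<and> double_root a s}"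
    by (simp add: dual_surface_def projectivization_def conj_ac)
  then show ?thesis by (simp add: double_root_locus)
qed

text \<open>Divisibility by a squared linear form makes the gradient vanish at its root by the Leibniz rule;
  conversely the equations for the double root determine the remaining linear factor.\<close>

lemma has_multiple_root_binary_cubic_iff:
  "has_multiple_root (binary_cubic a) \<longleftrightarrow> (\<exists>s. s \<noteq> 0 \<and> double_root a s)"
proof -
  have "(mconst (s $ 2) * mvar 1 - mconst (s $ 1) * mvar 2) ^ 2 dvd binary_cubic a \<longleftrightarrow> double_root a s"
    if s0: "s \<noteq> 0" for s :: "complex ^ 2"
  proof
    assume "(mconst (s $ 2) * mvar 1 - mconst (s $ 1) * mvar 2) ^ 2 dvd binary_cubic a"
    then obtain K where "binary_cubic a = (mconst (s $ 2) * mvar 1 - mconst (s $ 1) * mvar 2) ^ 2 * K"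
      by (rule dvdE)
    then have "gradient (binary_cubic a) s
        = gradient ((mconst (s $ 2) * mvar 1 - mconst (s $ 1) * mvar 2) ^ 2 * K) s" by simp
    also have "\<dots> = 0" by (simp add: vec_eq_iff mult.commute)
    finally have "gradient (binary_cubic a) s = 0" .
    moreover have "gradient (binary_cubic a) s = vector
        [3 * a $ 1 * (s $ 1) ^ 2 + 2 * a $ 2 * s $ 1 * s $ 2 + a $ 3 * (s $ 2) ^ 2,
         a $ 2 * (s $ 1) ^ 2 + 2 * a $ 3 * s $ 1 * s $ 2 + 3 * a $ 4 * (s $ 2) ^ 2]"
      by (simp add: binary_cubic_def vec2_eq_iff) (simp add: axis_def algebra_simps)
    ultimately show "double_root a s" by (simp add: double_root_def vec2_eq_iff)
  next
    assume d: "double_root a s"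
    obtain m n where mn: "a $ 1 = (s $ 2) ^ 2 * m" "a $ 2 = (s $ 2) ^ 2 * n - 2 * s $ 1 * s $ 2 * m"
      "a $ 3 = (s $ 1) ^ 2 * m - 2 * s $ 1 * s $ 2 * n" "a $ 4 = (s $ 1) ^ 2 * n"
    proof (cases "s $ 2 = 0")
      case True
      with s0 have s1: "s $ 1 \<noteq> 0" by (auto simp: vec2_eq_iff)
      with d True have "a $ 1 = 0" "a $ 2 = 0" by (auto simp: double_root_def)
      with True s1 show thesis
        by (intro that[of "a $ 3 / (s $ 1) ^ 2" "a $ 4 / (s $ 1) ^ 2"]) simp_all
    next
      case False
      define m where "m = a $ 1 / (s $ 2) ^ 2"
      define n where "n = (a $ 2 + 2 * s $ 1 * s $ 2 * m) / (s $ 2) ^ 2"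
      have m: "a $ 1 = (s $ 2) ^ 2 * m" and n: "a $ 2 = (s $ 2) ^ 2 * n - 2 * s $ 1 * s $ 2 * m"
        using False by (simp_all add: m_def n_def)
      have "(s $ 2) ^ 2 * a $ 3 = (s $ 2) ^ 2 * ((s $ 1) ^ 2 * m - 2 * s $ 1 * s $ 2 * n)"
        using d m n by (simp add: double_root_def) algebra
      then have a3: "a $ 3 = (s $ 1) ^ 2 * m - 2 * s $ 1 * s $ 2 * n" using False by simp
      have "3 * (s $ 2) ^ 2 * a $ 4 = 3 * (s $ 2) ^ 2 * ((s $ 1) ^ 2 * n)"
        using d n a3 by (simp add: double_root_def) algebra
      then have "a $ 4 = (s $ 1) ^ 2 * n" using False by simp
      with m n a3 show thesis by (rule that)
    qed
    have "binary_cubic a = (mconst (s $ 2) * mvar 1 - mconst (s $ 1) * mvar 2) ^ 2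
        * (mconst m * mvar 1 + mconst n * mvar 2)"
      by (rule mpoly_eqI) (simp add: binary_cubic_def mn, algebra)
    then show "(mconst (s $ 2) * mvar 1 - mconst (s $ 1) * mvar 2) ^ 2 dvd binary_cubic a" by simp
  qed
  then show ?thesis unfolding has_multiple_root_def by blast
qed

lemma discriminant_surface_eq: "discriminant_surface = proj_map binomial_scaling (zero_locus disc_form)"
  unfolding discriminant_surface_def has_multiple_root_binary_cubic_iff by (rule double_root_locus)


section \<open>Recognizing a cusp\<close>

lemma has_derivative_vecI:
  fixes f :: "'a::real_normed_vector \<Rightarrow> complex ^ 'n::finite"
  assumes "\<And>i. ((\<lambda>x. f x $ i) has_derivative (\<lambda>v. f' v $ i)) (at x)"
  shows "(f has_derivative f') (at x)"
  unfolding has_derivative_componentwise_within[of f f' x UNIV]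
proof
  fix b :: "complex ^ 'n" assume "b \<in> Basis"
  then obtain i c where b: "b = axis i c" by (auto simp: Basis_vec_def)
  show "((\<lambda>x. f x \<bullet> b) has_derivative (\<lambda>x. f' x \<bullet> b)) (at x)"
    unfolding b inner_axis by (intro has_derivative_inner_left assms)
qed

lemma continuous_gradient: "continuous_on S (\<lambda>x. gradient F x $ i)"
proof (induction F rule: mpoly_induct)
  case (mult F G)
  have "continuous_on S (\<lambda>x. meval F x * gradient G x $ i + meval G x * gradient F x $ i)"
    using mult by (intro continuous_on_add continuous_on_mult continuous_meval)
  then show ?case by simp
qed (simp_all add: continuous_on_add)

text \<open>The chart in which the equation becomes \<open>y\<^sup>2 = x\<^sup>3\<close> only has to be given in the easy direction,
  by polynomials; the inverse function theorem supplies the local biholomorphism.\<close>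

lemma cusp_at_zeroI:
  fixes P :: "2 \<Rightarrow> 2 mpoly"
  assumes zero: "\<And>i. meval (P i) 0 = 0"
    and J: "invertible (\<chi> i. gradient (P i) 0)"
    and f: "\<And>w. f w = (meval (P 2) w) ^ 2 - (meval (P 1) w) ^ 3"
  shows "cusp_at f 0"
proof -
  define g :: "complex ^ 2 \<Rightarrow> complex ^ 2" where "g w = (\<chi> i. meval (P i) w)" for w
  define J where "J w = (\<chi> i. gradient (P i) w)" for w
  have blin: "bounded_linear ((*v) M)" for M :: "complex ^ 2 ^ 2"
    by (rule matrix_vector_mul_bounded_linear)
  define J' where "J' w = Blinfun ((*v) (J w))" for w
  have J': "blinfun_apply (J' w) = (*v) (J w)" for w
    by (simp add: J'_def bounded_linear_Blinfun_apply[OF blin])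
  have J_mult: "(J w *v v) $ i = scalar_product (gradient (P i) w) v" for w v i
    by (simp add: J_def matrix_vector_mult_def scalar_product_def)
  have der: "(g has_derivative blinfun_apply (J' w)) (at w)" for w
    unfolding J' by (rule has_derivative_vecI) (simp add: g_def J_mult has_derivative_meval)
  have cont: "continuous_on UNIV J'"
  proof (rule continuous_on_blinfun_componentwise)
    fix b :: "complex ^ 2"
    have "continuous_on UNIV (\<lambda>w. \<chi> i. scalar_product (gradient (P i) w) b)"
      unfolding scalar_product_def
      by (intro continuous_on_vec_lambda continuous_on_sum continuous_on_mult continuous_gradient continuous_on_const)
    moreover have "blinfun_apply (J' w) b = (\<chi> i. scalar_product (gradient (P i) w) b)" for w
      by (simp add: J' vec_eq_iff J_mult)
    ultimately show "continuous_on UNIV (\<lambda>w. blinfun_apply (J' w) b)" by simp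
  qed
  obtain B where B: "B ** J 0 = mat 1" using J by (auto simp: J_def invertible_def)
  have inv: "Blinfun ((*v) B) o\<^sub>L J' 0 = id_blinfun"
    by (rule blinfun_eqI) (simp add: bounded_linear_Blinfun_apply[OF blin] J' matrix_vector_mul_assoc B)
  obtain U V h h' where UV: "open U" "U \<subseteq> UNIV" "0 \<in> U" "open V" "g 0 \<in> V" "homeomorphism U V g h"
    and h: "\<And>y. y \<in> V \<Longrightarrow> (h has_derivative (h' y)) (at y)"
    and h': "\<And>y. y \<in> V \<Longrightarrow> h' y = inv (blinfun_apply (J' (h y)))"
    and bij: "\<And>y. y \<in> V \<Longrightarrow> bij (blinfun_apply (J' (h y)))"
    by (rule inverse_function_theorem[OF open_UNIV der cont UNIV_I inv]) (rule that)
  have g0: "g 0 = 0" by (simp add: g_def vec_eq_iff zero)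
  have hg: "h ` V = U" "g ` U = V" "\<And>y. y \<in> V \<Longrightarrow> g (h y) = y" "\<And>x. x \<in> U \<Longrightarrow> h (g x) = x"
    using UV(6) by (auto simp: homeomorphism_def)
  have "holomorphic_map_on h V"
    unfolding holomorphic_map_on_def
  proof
    fix y assume y: "y \<in> V"
    have bij': "bij ((*v) (J (h y)))" using bij[OF y] by (simp add: J')
    then obtain M where M: "M ** J (h y) = mat 1"
      using matrix_left_invertible_injective[of "J (h y)"] by (auto simp: bij_def)
    have "inv ((*v) (J (h y))) = (*v) M"
    proof
      fix v
      have "M *v (J (h y) *v (inv ((*v) (J (h y))) v)) = M *v v"
        using bij' by (simp add: bij_def surj_f_inv_f)
      then show "inv ((*v) (J (h y))) v = M *v v"
        by (simp add: matrix_vector_mul_assoc M)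
    qed
    then show "\<exists>M. (h has_derivative (\<lambda>v. M *v v)) (at y)"
      using h[OF y] h'[OF y] by (auto simp: J')
  qed
  moreover have "holomorphic_map_on g U"
    unfolding holomorphic_map_on_def using der J' by metis
  moreover have "holomorphic_fun_on (\<lambda>_. 1) V"
  proof -
    have "scalar_product 0 = (\<lambda>v :: complex ^ 2. 0 :: complex)" by auto
    then show ?thesis unfolding holomorphic_fun_on_def by (intro ballI exI[of _ 0]) simp
  qed
  moreover have "f (h z) = (z $ 2) ^ 2 - (z $ 1) ^ 3" if "z \<in> V" for z
  proof -
    have "f (h z) = (g (h z) $ 2) ^ 2 - (g (h z) $ 1) ^ 3" by (simp add: f g_def)
    then show ?thesis using hg(3)[OF that] by simp
  qed
  moreover have "h 0 = 0" using hg(4)[OF UV(3)] g0 by simp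
  ultimately show ?thesis
    unfolding cusp_at_def locally_analytically_equivalent_def
    using UV hg g0 by (intro exI[of _ V] exI[of _ U] exI[of _ h] exI[of _ g] exI[of _ "\<lambda>_. 1"]) simp
qed

text \<open>A cusp is not an ordinary double point: comparing second order terms in
  \<open>f (\<phi> z) = e z * (y\<^sup>2 - x\<^sup>3)\<close> shows that the quadratic part of \<open>f\<close> is a square of a linear form.
  The quadratic part enters as the limit \<open>g 0\<close> of \<open>w \<mapsto> f (t w) / t\<^sup>2\<close> for \<open>t \<rightarrow> 0\<close>.\<close>

lemma cusp_at_zero_imp_degenerate:
  fixes f :: "complex ^ 2 \<Rightarrow> complex"
  assumes cusp: "cusp_at f 0"
    and f: "\<And>t w. f (t *s w) = t ^ 2 * g t w"
    and g: "continuous_on UNIV (\<lambda>(t, w). g t w)"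
    and g0: "\<And>w. g 0 w = a * (w $ 1) ^ 2 + b * w $ 1 * w $ 2 + c * (w $ 2) ^ 2"
  shows "b ^ 2 = 4 * a * c"
proof -
  obtain U V :: "(complex ^ 2) set" and \<phi> \<psi> :: "complex ^ 2 \<Rightarrow> complex ^ 2" and e :: "complex ^ 2 \<Rightarrow> complex"
    where U: "open U" "0 \<in> U" and V: "open V" "0 \<in> V"
    and hol: "holomorphic_map_on \<phi> U" "holomorphic_map_on \<psi> V" "holomorphic_fun_on e U"
    and \<psi>\<phi>: "\<forall>z\<in>U. \<psi> (\<phi> z) = z" and \<phi>0: "\<phi> 0 = 0"
    and fe: "\<forall>z\<in>U. f (\<phi> z) = e z * ((z $ 2) ^ 2 - (z $ 1) ^ 3)"
    using cusp unfolding cusp_at_def locally_analytically_equivalent_def by (elim exE conjE) (rule that)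
  obtain M where M: "(\<phi> has_derivative (*v) M) (at 0)"
    using hol(1) U(2) unfolding holomorphic_map_on_def by blast
  obtain N where N: "(\<psi> has_derivative (*v) N) (at (\<phi> 0))"
    using hol(2) V(2) \<phi>0 unfolding holomorphic_map_on_def by auto
  have "((\<lambda>z. z) has_derivative (*v) N \<circ> (*v) M) (at 0)"
    by (rule has_derivative_transform_within_open[OF diff_chain_at[OF M N] U]) (use \<psi>\<phi> in auto)
  then have "(*v) N \<circ> (*v) M = (\<lambda>z. z)"
    using has_derivative_unique has_derivative_ident by blast
  then have NM: "N ** M = mat 1"
    by (simp add: matrix_eq o_def fun_eq_iff matrix_vector_mul_assoc)
  then have detM: "det M \<noteq> 0"
    by (metis det_I det_mul mult_zero_right zero_neq_one)
  have quad: "g 0 (M *v v) = e 0 * (v $ 2) ^ 2" for v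
  proof -
    define u where "u t = (1 / t) *s \<phi> (t *s v)" for t
    have "((\<lambda>t. \<phi> (0 + t *s v)) has_derivative (\<lambda>t. M *v (t *s v))) (at 0)"
      using diff_chain_at[OF has_derivative_along_line[of 0 v 0], of \<phi> "(*v) M"] M by (simp add: o_def)
    then have d: "((\<lambda>t. \<phi> (t *s v)) has_derivative (\<lambda>t. t *s (M *v v))) (at 0)"
      by (simp add: vector_scalar_commute)
    have "((\<lambda>t. \<phi> (t *s v) $ i) has_field_derivative (M *v v) $ i) (at 0)" for i
      using bounded_linear.has_derivative[OF bounded_linear_vec_nth d, of i]
      by (simp add: has_field_derivative_def mult.commute[of _ "(M *v v) $ i"])
    then have "((\<lambda>t. \<phi> (t *s v) $ i / t) \<longlongrightarrow> (M *v v) $ i) (at 0)" for i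
      unfolding has_field_derivative_iff by (simp add: \<phi>0)
    then have u_lim: "(u \<longlongrightarrow> M *v v) (at 0)"
      by (intro vec_tendstoI) (simp add: u_def)
    have "isCont (\<lambda>(t, w). g t w) (0, M *v v)"
      using g by (simp add: continuous_on_eq_continuous_at)
    moreover have "((\<lambda>t. (t, u t)) \<longlongrightarrow> (0, M *v v)) (at 0)"
      by (intro tendsto_Pair u_lim tendsto_ident_at)
    ultimately have lim1: "((\<lambda>t. g t (u t)) \<longlongrightarrow> g 0 (M *v v)) (at 0)"
      using isCont_tendsto_compose by fastforce
    have line_cont: "isCont (\<lambda>t. t *s v) (0 :: complex)"
      using continuous_smult_line[of 0 v] by (simp add: continuous_on_eq_continuous_at)
    have "isCont e (0 *s v)"
      using hol(3) U(2) unfolding holomorphic_fun_on_def by (auto intro: has_derivative_continuous)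
    from isCont_o2[OF line_cont this]
    have "((\<lambda>t. e (t *s v)) \<longlongrightarrow> e 0) (at 0)"
      by (simp add: isCont_def)
    then have "((\<lambda>t. e (t *s v) * ((v $ 2) ^ 2 - t * (v $ 1) ^ 3)) \<longlongrightarrow> e 0 * ((v $ 2) ^ 2 - 0 * (v $ 1) ^ 3)) (at 0)"
      by (intro tendsto_intros)
    moreover have "\<forall>\<^sub>F t in at 0. e (t *s v) * ((v $ 2) ^ 2 - t * (v $ 1) ^ 3) = g t (u t)"
    proof -
      have "open ((\<lambda>t. t *s v) -` U)"
        using U(1) continuous_smult_line[of 0 v] by (intro open_vimage) simp_all
      then have "\<forall>\<^sub>F t in at 0. t *s v \<in> U"
        using U(2) eventually_nhds_in_open[of "(\<lambda>t. t *s v) -` U" 0] eventually_nhds_x_imp_x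
        by (simp add: eventually_at_filter eventually_mono)
      moreover have "\<forall>\<^sub>F t in at 0. t \<noteq> (0 :: complex)" by (simp add: eventually_at_filter)
      ultimately show ?thesis
      proof eventually_elim
        case (elim t)
        have "t *s u t = \<phi> (t *s v)" using elim(2) by (simp add: u_def)
        then have "t ^ 2 * g t (u t) = f (\<phi> (t *s v))" using f[of t "u t"] by simp
        also have "\<dots> = t ^ 2 * (e (t *s v) * ((v $ 2) ^ 2 - t * (v $ 1) ^ 3))"
          using bspec[OF fe elim(1)] by (simp add: algebra_simps power2_eq_square power3_eq_cube)
        finally show ?case using elim(2) by simp
      qed
    qed
    ultimately have "((\<lambda>t. g t (u t)) \<longlongrightarrow> e 0 * (v $ 2) ^ 2) (at 0)"
      using tendsto_cong by fastforce
    then show ?thesis using lim1 tendsto_unique[OF at_neq_bot] by blast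
  qed
  define p q r s where "p = M $ 1 $ 1" and "q = M $ 1 $ 2" and "r = M $ 2 $ 1" and "s = M $ 2 $ 2"
  have M_mult: "(M *v v) $ 1 = p * v $ 1 + q * v $ 2" "(M *v v) $ 2 = r * v $ 1 + s * v $ 2" for v
    by (simp_all add: matrix_vector_mult_def sum_2 p_def q_def r_def s_def)
  have "a * p ^ 2 + b * p * r + c * r ^ 2 = 0"
    "a * q ^ 2 + b * q * s + c * s ^ 2 = e 0"
    "a * (p + q) ^ 2 + b * (p + q) * (r + s) + c * (r + s) ^ 2 = e 0"
    using quad[of "vector [1, 0]"] quad[of "vector [0, 1]"] quad[of "vector [1, 1]"]
    by (simp_all add: g0 M_mult)
  then have "(b ^ 2 - 4 * a * c) * (p * s - q * r) ^ 2 = 0" by algebra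
  moreover have "p * s - q * r \<noteq> 0" using detM by (simp add: det_2 p_def q_def r_def s_def)
  ultimately show ?thesis by simp
qed


section \<open>The twisted cubic is a cuspidal curve of the discriminant\<close>

lemma invertible_iff_det_2: "invertible (M :: complex ^ 2 ^ 2) \<longleftrightarrow> M $ 1 $ 1 * M $ 2 $ 2 - M $ 1 $ 2 * M $ 2 $ 1 \<noteq> 0"
  by (simp add: invertible_det_nz det_2)

text \<open>Completing the cube turns \<open>X\<^sup>3 + 3 b X\<^sup>2 Y + 3 c X Y\<^sup>2 + d Y\<^sup>3\<close> into \<open>X\<^sup>3 + 3 p X Y\<^sup>2 + q Y\<^sup>3\<close>, which does not
  change the discriminant and brings it into the form \<open>q\<^sup>2 + 4 p\<^sup>3\<close> of a cusp.\<close>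

lemma depressed_cubic_identity:
  fixes b c d :: complex
  shows "(d - b * c) ^ 2 - 4 * (c - b ^ 2) * (b * d - c ^ 2) = (d - 3 * b * c + 2 * b ^ 3) ^ 2 + 4 * (c - b ^ 2) ^ 3"
  by algebra

text \<open>On a plane transversal to the cubic at \<open>X\<^sup>3\<close> the coefficient \<open>b\<close> is a linear combination of \<open>c\<close> and
  \<open>d\<close>, here the two coordinates. Then \<open>p\<close> and \<open>q\<close> agree with \<open>c\<close> and \<open>d\<close> to first order, so they are
  local coordinates in which the section is a cusp.\<close>

lemma depressed_cubic_cusp: "cusp_at (\<lambda>w. (w $ 2 - 3 * (l * w $ 1 + m * w $ 2) * w $ 1 + 2 * (l * w $ 1 + m * w $ 2) ^ 3) ^ 2
    + 4 * (w $ 1 - (l * w $ 1 + m * w $ 2) ^ 2) ^ 3) 0"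
proof -
  obtain k :: complex where k: "k ^ 3 = - 4" by (rule cube_root_exists)
  define b :: "2 mpoly" where "b = mconst l * mvar 1 + mconst m * mvar 2"
  define P :: "2 \<Rightarrow> 2 mpoly" where
    "P i = (if i = 1 then mconst k * (mvar 1 - b ^ 2) else mvar 2 - mconst 3 * b * mvar 1 + mconst 2 * b ^ 3)" for i
  have "meval b 0 = 0" by (simp add: b_def)
  then have "gradient (P 1) 0 = k *s axis 1 1" "gradient (P 2) 0 = axis 2 1"
    by (simp_all add: P_def)
  moreover have "k \<noteq> 0" using k by auto
  ultimately have "invertible (\<chi> i. gradient (P i) 0)"
    by (simp add: invertible_iff_det_2 axis_def)
  moreover have "(k * x) ^ 3 = - 4 * x ^ 3" for x :: complex
    by (simp add: power_mult_distrib k)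
  ultimately show ?thesis
    by (intro cusp_at_zeroI[of P]) (simp_all add: P_def b_def)
qed

text \<open>The rows span the osculating flag at the point \<open>nu (1, r)\<close>, which is the first row; the second row
  spans the tangent direction. They are the images of the standard basis under the substitution
  \<open>X \<mapsto> X + r Y\<close>, which preserves the discriminant; this reduces every point of the cubic except
  \<open>nu (0, 1)\<close> to the point \<open>X\<^sup>3\<close>.\<close>

definition osculating :: "complex \<Rightarrow> complex ^ 4 ^ 4" where
  "osculating r = vector [vector [1, r, r ^ 2, r ^ 3], vector [0, 1, 2 * r, 3 * r ^ 2],
     vector [0, 0, 1, 3 * r], vector [0, 0, 0, 1]]"

lemma disc_form_osculating:
  "meval disc_form (osculating r $ 1 + b *s osculating r $ 2 + c *s osculating r $ 3 + d *s osculating r $ 4)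
    = (d - b * c) ^ 2 - 4 * (c - b ^ 2) * (b * d - c ^ 2)"
  by (simp add: osculating_def meval_disc_form meval_quadrics) algebra

lemma osculating_expand:
  obtains a b c d where "v = a *s osculating r $ 1 + b *s osculating r $ 2 + c *s osculating r $ 3 + d *s osculating r $ 4"
proof -
  define b where "b = v $ 2 - v $ 1 * r"
  define c where "c = v $ 3 - v $ 1 * r ^ 2 - b * (2 * r)"
  define d where "d = v $ 4 - v $ 1 * r ^ 3 - b * (3 * r ^ 2) - c * (3 * r)"
  show thesis
    by (rule that[of "v $ 1" b c d]) (simp add: vec4_eq_iff osculating_def b_def c_def d_def, algebra)
qed

lemma cusp_of_transversal_section:
  assumes "scalar_product h (osculating r $ 1) = 0" "scalar_product h (osculating r $ 2) \<noteq> 0"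
  shows "plane_section_has_cusp_at disc_form h (pt (osculating r $ 1))"
proof -
  define x where "x = osculating r $ 1"
  define l where "l = - scalar_product h (osculating r $ 3) / scalar_product h (osculating r $ 2)"
  define m where "m = - scalar_product h (osculating r $ 4) / scalar_product h (osculating r $ 2)"
  define y where "y = l *s osculating r $ 2 + osculating r $ 3"
  define z where "z = m *s osculating r $ 2 + osculating r $ 4"
  have hl: "scalar_product h (osculating r $ 3) = - l * scalar_product h (osculating r $ 2)"
    and hm: "scalar_product h (osculating r $ 4) = - m * scalar_product h (osculating r $ 2)"
    using assms(2) by (simp_all add: l_def m_def)
  have "vec.span {x, y, z} = {v. scalar_product h v = 0}"
  proof (intro subset_antisym subsetI)
    fix v assume "v \<in> vec.span {x, y, z}"
    moreover have "vec.subspace {v. scalar_product h v = 0}"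
      by (rule vec.subspaceI) simp_all
    moreover have "{x, y, z} \<subseteq> {v. scalar_product h v = 0}"
      using assms(1) by (auto simp: x_def y_def z_def hl hm)
    ultimately show "v \<in> {v. scalar_product h v = 0}" using vec.span_minimal by blast
  next
    fix v assume v: "v \<in> {v. scalar_product h v = 0}"
    obtain a b c d where e: "v = a *s osculating r $ 1 + b *s osculating r $ 2 + c *s osculating r $ 3 + d *s osculating r $ 4"
      by (rule osculating_expand)
    have "(b - l * c - m * d) * scalar_product h (osculating r $ 2) = 0"
      using v assms(1) by (simp add: e hl hm algebra_simps)
    then have "b - l * c - m * d = 0" using assms(2) by simp
    then have b: "b = l * c + m * d" by (simp add: algebra_simps)
    have "v = a *s x + c *s y + d *s z"
      by (simp add: e b x_def y_def z_def vec_eq_iff algebra_simps)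
    then show "v \<in> vec.span {x, y, z}"
      by (simp add: vec.span_add vec.span_scale vec.span_base)
  qed
  moreover have "cusp_at (\<lambda>w. meval disc_form (x + w $ 1 *s y + w $ 2 *s z)) 0"
  proof -
    have "x + w $ 1 *s y + w $ 2 *s z = osculating r $ 1 + (l * w $ 1 + m * w $ 2) *s osculating r $ 2
        + w $ 1 *s osculating r $ 3 + w $ 2 *s osculating r $ 4" for w :: "complex ^ 2"
      by (simp add: x_def y_def z_def vec_eq_iff algebra_simps)
    then show ?thesis
      using depressed_cubic_cusp[of l m] by (simp only: disc_form_osculating depressed_cubic_identity)
  qed
  ultimately show ?thesis
    unfolding plane_section_has_cusp_at_def x_def by blast
qed

lemma nu_eq_smult_osculating: "s $ 1 \<noteq> 0 \<Longrightarrow> nu s = (s $ 1) ^ 3 *s osculating (s $ 2 / s $ 1) $ 1"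
  by (simp add: nu_def osculating_def vec4_eq_iff field_simps power2_eq_square power3_eq_cube)

text \<open>A plane is in general position if it avoids the point \<open>nu (0, 1)\<close> and contains no tangent line; the
  latter means that the plane, seen as a binary cubic, has nonzero discriminant.\<close>

lemma cuspidal_curve_disc_form: "cuspidal_curve disc_form std_cubic"
proof -
  obtain B where B: "binomial_scaling ** B = mat 1" "B ** binomial_scaling = mat 1"
    using invertible_binomial_scaling by (rule inverse_matrixE)
  define G where "G = mvar 4 * lin_subst B disc_form"
  have "homogeneous (1 + 4) G"
    unfolding G_def by (intro homogeneous_mult homogeneous_var homogeneous_lin_subst homogeneous_disc_form)
  moreover have "G \<noteq> 0"
  proof
    assume "G = 0"
    then have "meval G (binomial_scaling *v vector [1, 0, 0, 1]) = 0" by simp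
    moreover have "meval (lin_subst B disc_form) (binomial_scaling *v vector [1, 0, 0, 1]) = 1"
      unfolding meval_lin_subst inverse_matrix_vector[OF B(2)] by (simp add: meval_disc_form meval_quadrics)
    ultimately show False by (simp add: G_def binomial_scaling_mult)
  qed
  moreover have "plane_section_has_cusp_at disc_form h p"
    if h: "meval G h \<noteq> 0" and p: "p \<in> std_cubic" "p \<in> hyperplane h" for h p
  proof -
    obtain s where s: "s \<noteq> 0" "p = pt (nu s)" using p(1) by (auto simp: std_cubic_def)
    then have hs: "scalar_product h (nu s) = 0"
      using p(2) pt_in_hyperplane_iff[of "nu s" h] by (simp add: nu_eq_zero_iff)
    have "s $ 1 \<noteq> 0"
    proof
      assume "s $ 1 = 0"
      with hs s(1) have "h $ 4 = 0" by (auto simp: scalar_product_4 nu_def vec2_eq_iff)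
      with h show False by (simp add: G_def)
    qed
    define r where "r = s $ 2 / s $ 1"
    have nu: "nu s = (s $ 1) ^ 3 *s osculating r $ 1"
      unfolding r_def using \<open>s $ 1 \<noteq> 0\<close> by (rule nu_eq_smult_osculating)
    have h1: "scalar_product h (osculating r $ 1) = 0"
      using hs \<open>s $ 1 \<noteq> 0\<close> by (simp add: nu)
    have "scalar_product h (osculating r $ 2) \<noteq> 0"
    proof
      assume "scalar_product h (osculating r $ 2) = 0"
      with h1 have "h $ 1 + h $ 2 * r + h $ 3 * r ^ 2 + h $ 4 * r ^ 3 = 0"
        "h $ 2 + h $ 3 * (2 * r) + h $ 4 * (3 * r ^ 2) = 0"
        by (simp_all add: scalar_product_4 osculating_def)
      then have "3 * h $ 1 + 2 * h $ 2 * r + h $ 3 * r ^ 2 = 0" "h $ 2 + 2 * h $ 3 * r + 3 * h $ 4 * r ^ 2 = 0"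
        by algebra+
      then have "double_root h (vector [1, r])" by (simp add: double_root_def)
      then have "double_root (binomial_scaling *v (B *v h)) (vector [1, r])"
        by (simp add: inverse_matrix_vector[OF B(1)])
      moreover have "vector [1, r] \<noteq> (0 :: complex ^ 2)" by (simp add: vec2_eq_iff)
      ultimately have "meval disc_form (B *v h) = 0" using disc_form_zero_iff_double_root by blast
      with h show False by (simp add: G_def)
    qed
    from cusp_of_transversal_section[OF h1 this] show ?thesis
      using \<open>s $ 1 \<noteq> 0\<close> by (simp add: s(2) nu pt_smult)
  qed
  ultimately show ?thesis
    unfolding cuspidal_curve_def for_general_hyperplane_def singular_locus_disc_form by blast
qed


section \<open>Quartic forms singular along the twisted cubic\<close>

text \<open>The exponents of the second, third and fourth variable of a quartic monomial determine that of the
  first.\<close>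

definition quartic_exponents :: "(nat \<times> nat \<times> nat) set" where
  "quartic_exponents = (SIGMA j:{..4}. SIGMA k:{..4 - j}. {..4 - j - k})"

lemma sum_quartic_exponents:
  "(\<Sum>e\<in>quartic_exponents. f e) = f (0, 0, 0) + f (0, 0, 1) + f (0, 0, 2) + f (0, 0, 3) + f (0, 0, 4) + f (0, 1, 0) + f (0, 1, 1) + f
     (0, 1, 2) + f (0, 1, 3) + f (0, 2, 0) + f (0, 2, 1) + f (0, 2, 2) + f (0, 3, 0) + f (0, 3, 1) + f
     (0, 4, 0) + f (1, 0, 0) + f (1, 0, 1) + f (1, 0, 2) + f (1, 0, 3) + f (1, 1, 0) + f (1, 1, 1) + f
     (1, 1, 2) + f (1, 2, 0) + f (1, 2, 1) + f (1, 3, 0) + f (2, 0, 0) + f (2, 0, 1) + f (2, 0, 2) + f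
     (2, 1, 0) + f (2, 1, 1) + f (2, 2, 0) + f (3, 0, 0) + f (3, 0, 1) + f (3, 1, 0) + f (4, 0, 0)"
proof -
  have at: "{..0 :: nat} = {0}" "{..1 :: nat} = {0, 1}" "{..2 :: nat} = {0, 1, 2}"
    "{..3 :: nat} = {0, 1, 2, 3}" "{..4 :: nat} = {0, 1, 2, 3, 4}"
    by auto
  have "(\<Sum>e\<in>quartic_exponents. f e) = (\<Sum>j\<le>4. \<Sum>k\<le>4 - j. \<Sum>l\<le>4 - j - k. f (j, k, l))"
    by (simp add: quartic_exponents_def sum.Sigma)
  then show ?thesis by (simp add: at at(2)[unfolded One_nat_def] add.assoc)
qed

definition quartic_monomial :: "nat \<times> nat \<times> nat \<Rightarrow> 4 mpoly" where
  "quartic_monomial = (\<lambda>(j, k, l). mvar 1 ^ (4 - j - k - l) * mvar 2 ^ j * mvar 3 ^ k * mvar 4 ^ l)"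

lemma finite_quartic_exponents: "finite quartic_exponents"
  by (simp add: quartic_exponents_def)

lemma quartic_form_expansion:
  fixes F :: "4 mpoly"
  assumes "homogeneous 4 F"
  obtains c where "F = (\<Sum>e\<in>quartic_exponents. mconst (c e) * quartic_monomial e)"
proof -
  define ex :: "nat \<times> nat \<times> nat \<Rightarrow> 4 \<Rightarrow>\<^sub>0 nat" where
    "ex = (\<lambda>(j, k, l). Poly_Mapping.single 1 (4 - j - k - l) + Poly_Mapping.single 2 j
       + Poly_Mapping.single 3 k + Poly_Mapping.single 4 l)"
  have ex_lookup: "Poly_Mapping.lookup (ex (j, k, l)) 1 = 4 - j - k - l"
    "Poly_Mapping.lookup (ex (j, k, l)) 2 = j" "Poly_Mapping.lookup (ex (j, k, l)) 3 = k"
    "Poly_Mapping.lookup (ex (j, k, l)) 4 = l" for j k l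
    by (simp_all add: ex_def lookup_add lookup_single)
  have inj: "inj_on ex quartic_exponents"
  proof (rule inj_onI)
    fix a b assume "ex a = ex b"
    then show "a = b" by (metis ex_lookup(2-4) prod_cases3)
  qed
  have keys: "Poly_Mapping.keys F \<subseteq> ex ` quartic_exponents"
  proof
    fix m assume "m \<in> Poly_Mapping.keys F"
    with assms have deg: "Poly_Mapping.lookup m 1 + Poly_Mapping.lookup m 2 + Poly_Mapping.lookup m 3
        + Poly_Mapping.lookup m 4 = 4"
      by (auto simp: homogeneous_def sum_4)
    define e where "e = (Poly_Mapping.lookup m 2, Poly_Mapping.lookup m 3, Poly_Mapping.lookup m 4)"
    have "Poly_Mapping.lookup m i = Poly_Mapping.lookup (ex e) i" for i
      using deg exhaust_4[of i] by (auto simp: e_def ex_lookup)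
    then have "m = ex e" by (rule poly_mapping_eqI)
    moreover have "e \<in> quartic_exponents" using deg by (auto simp: e_def quartic_exponents_def)
    ultimately show "m \<in> ex ` quartic_exponents" by blast
  qed
  have "F = (\<Sum>e\<in>quartic_exponents. mconst (Poly_Mapping.lookup F (ex e)) * quartic_monomial e)"
  proof (rule mpoly_eqI)
    fix x :: "complex ^ 4"
    have prod4: "(\<Prod>i\<in>UNIV. g i) = g 1 * g 2 * g 3 * g (4 :: 4)" for g :: "4 \<Rightarrow> complex"
      unfolding UNIV_4 by (simp add: mult.assoc)
    have "meval F x = (\<Sum>m\<in>ex ` quartic_exponents.
        Poly_Mapping.lookup F m * (\<Prod>i\<in>UNIV. (x $ i) ^ Poly_Mapping.lookup m i))"
      using keys finite_quartic_exponents by (intro meval_superset) auto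
    also have "\<dots> = (\<Sum>e\<in>quartic_exponents. Poly_Mapping.lookup F (ex e)
        * (\<Prod>i\<in>UNIV. (x $ i) ^ Poly_Mapping.lookup (ex e) i))"
      by (simp add: sum.reindex[OF inj])
    also have "\<dots> = meval (\<Sum>e\<in>quartic_exponents. mconst (Poly_Mapping.lookup F (ex e)) * quartic_monomial e) x"
      by (auto simp: quartic_monomial_def prod4 ex_lookup mult.assoc intro!: sum.cong)
    finally show "meval F x = meval (\<Sum>e\<in>quartic_exponents. mconst (Poly_Mapping.lookup F (ex e))
        * quartic_monomial e) x" .
  qed
  then show thesis by (rule that)
qed

lemma sum_powers_zero_imp_coeffs_zero:
  fixes a :: "'a \<Rightarrow> complex"
  assumes "\<And>t. (\<Sum>e\<in>S. a e * t ^ d e) = 0"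
  shows "(\<Sum>e\<in>S. if d e = n then a e else 0) = 0"
proof -
  have "poly (\<Sum>e\<in>S. monom (a e) (d e)) t = 0" for t
    using assms[of t] by (simp add: poly_sum poly_monom)
  then have "(\<Sum>e\<in>S. monom (a e) (d e)) = 0" by (simp add: poly_all_0_iff_0[symmetric])
  then have "coeff (\<Sum>e\<in>S. monom (a e) (d e)) n = 0" by simp
  then show ?thesis by (simp add: coeff_sum)
qed

definition quadric_form :: "complex \<Rightarrow> complex \<Rightarrow> complex \<Rightarrow> complex \<Rightarrow> complex \<Rightarrow> complex \<Rightarrow> complex \<Rightarrow> complex \<Rightarrow> complex \<Rightarrow> complex" where
  "quadric_form A B C D E G x y z = A * x ^ 2 + B * y ^ 2 + C * z ^ 2 + D * x * y + E * x * z + G * y * z"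

text \<open>The square of the ideal of the twisted cubic contains all quartics singular along it. At
  \<open>nu (1, t)\<close> the partial derivatives of a monomial \<open>x\<^sub>1\<^sup>i x\<^sub>2\<^sup>j x\<^sub>3\<^sup>k x\<^sub>4\<^sup>l\<close> are, up to fixed powers of \<open>t\<close>, the numbers
  \<open>i\<close>, \<open>j\<close>, \<open>k\<close>, \<open>l\<close> times \<open>t\<close> to the weight \<open>j + 2 k + 3 l\<close>. So the linear conditions on the
  35 coefficients split by weight into systems with at most five unknowns, and their
  solutions depend on six parameters, one for each product of two quadrics.\<close>

lemma singular_quartic_is_quadric_form:
  fixes F :: "4 mpoly"
  assumes hom: "homogeneous 4 F" and sing: "\<And>t. gradient F (nu (vector [1, t])) = 0"
  obtains A B C D E G where
    "\<And>x. meval F x = quadric_form A B C D E G (meval q0 x) (meval q1 x) (meval q2 x)"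
proof -
  obtain c where F: "F = (\<Sum>e\<in>quartic_exponents. mconst (c e) * quartic_monomial e)"
    using hom by (rule quartic_form_expansion)
  define wt :: "nat \<times> nat \<times> nat \<Rightarrow> nat" where "wt = (\<lambda>(j, k, l). j + 2 * k + 3 * l)"
  have nu1: "nu (vector [1, t]) = vector [1, t, t ^ 2, t ^ 3]" for t
    by (simp add: nu_def)
  have g: "gradient F (nu (vector [1, t])) = (\<Sum>e\<in>quartic_exponents. c e *s gradient (quartic_monomial e) (nu (vector [1, t])))" for t
    by (simp add: F)
  have red: "t * of_nat k * t ^ (k - Suc 0) = of_nat k * t ^ k" for t :: complex and k
    by (cases k) simp_all
  have mon: "gradient (quartic_monomial (j, k, l)) (nu (vector [1, t])) $ 1 = of_nat (4 - j - k - l) * t ^ wt (j, k, l)"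
    "t * gradient (quartic_monomial (j, k, l)) (nu (vector [1, t])) $ 2 = of_nat j * t ^ wt (j, k, l)"
    "t ^ 2 * gradient (quartic_monomial (j, k, l)) (nu (vector [1, t])) $ 3 = of_nat k * t ^ wt (j, k, l)"
    "t ^ 3 * gradient (quartic_monomial (j, k, l)) (nu (vector [1, t])) $ 4 = of_nat l * t ^ wt (j, k, l)" for j k l t
  proof -
    show "gradient (quartic_monomial (j, k, l)) (nu (vector [1, t])) $ 1 = of_nat (4 - j - k - l) * t ^ wt (j, k, l)"
      by (simp add: quartic_monomial_def nu1 wt_def axis_def power_add flip: power_mult)
    have "t * gradient (quartic_monomial (j, k, l)) (nu (vector [1, t])) $ 2
        = (t * of_nat j * t ^ (j - Suc 0)) * (t ^ 2) ^ k * (t ^ 3) ^ l"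
      by (simp add: quartic_monomial_def nu1 axis_def)
    then show "t * gradient (quartic_monomial (j, k, l)) (nu (vector [1, t])) $ 2 = of_nat j * t ^ wt (j, k, l)"
      unfolding red by (simp add: wt_def power_add flip: power_mult)
    have "t ^ 2 * gradient (quartic_monomial (j, k, l)) (nu (vector [1, t])) $ 3
        = (t ^ 2 * of_nat k * (t ^ 2) ^ (k - Suc 0)) * t ^ j * (t ^ 3) ^ l"
      by (simp add: quartic_monomial_def nu1 axis_def)
    then show "t ^ 2 * gradient (quartic_monomial (j, k, l)) (nu (vector [1, t])) $ 3 = of_nat k * t ^ wt (j, k, l)"
      unfolding red by (simp add: wt_def power_add flip: power_mult)
    have "t ^ 3 * gradient (quartic_monomial (j, k, l)) (nu (vector [1, t])) $ 4
        = (t ^ 3 * of_nat l * (t ^ 3) ^ (l - Suc 0)) * t ^ j * (t ^ 2) ^ k"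
      by (simp add: quartic_monomial_def nu1 axis_def)
    then show "t ^ 3 * gradient (quartic_monomial (j, k, l)) (nu (vector [1, t])) $ 4 = of_nat l * t ^ wt (j, k, l)"
      unfolding red by (simp add: wt_def power_add flip: power_mult)
  qed
  have "(\<Sum>e\<in>quartic_exponents. (case e of (j, k, l) \<Rightarrow> of_nat j * c e) * t ^ wt e) = 0"
    "(\<Sum>e\<in>quartic_exponents. (case e of (j, k, l) \<Rightarrow> of_nat k * c e) * t ^ wt e) = 0"
    "(\<Sum>e\<in>quartic_exponents. (case e of (j, k, l) \<Rightarrow> of_nat l * c e) * t ^ wt e) = 0"
    "(\<Sum>e\<in>quartic_exponents. (case e of (j, k, l) \<Rightarrow> of_nat (4 - j - k - l) * c e) * t ^ wt e) = 0" for t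
  proof -
    have z: "(\<Sum>e\<in>quartic_exponents. c e * gradient (quartic_monomial e) (nu (vector [1, t])) $ i) = 0" for i
      using arg_cong[OF g[of t], of "\<lambda>v. v $ i"] by (simp add: sing sum_component)
    have zz: "(\<Sum>e\<in>quartic_exponents. c e * (s * gradient (quartic_monomial e) (nu (vector [1, t])) $ i)) = 0" for i s
      using arg_cong[OF z[of i], of "\<lambda>v. s * v"] by (simp add: sum_distrib_left mult_ac)
    show "(\<Sum>e\<in>quartic_exponents. (case e of (j, k, l) \<Rightarrow> of_nat j * c e) * t ^ wt e) = 0"
      unfolding zz[of t 2, symmetric] by (intro sum.cong) (auto simp: mon)
    show "(\<Sum>e\<in>quartic_exponents. (case e of (j, k, l) \<Rightarrow> of_nat k * c e) * t ^ wt e) = 0"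
      unfolding zz[of "t ^ 2" 3, symmetric] by (intro sum.cong) (auto simp: mon)
    show "(\<Sum>e\<in>quartic_exponents. (case e of (j, k, l) \<Rightarrow> of_nat l * c e) * t ^ wt e) = 0"
      unfolding zz[of "t ^ 3" 4, symmetric] by (intro sum.cong) (auto simp: mon)
    show "(\<Sum>e\<in>quartic_exponents. (case e of (j, k, l) \<Rightarrow> of_nat (4 - j - k - l) * c e) * t ^ wt e) = 0"
      unfolding z[of 1, symmetric] by (intro sum.cong) (auto simp: mon)
  qed
  note weighted = this[THEN sum_powers_zero_imp_coeffs_zero, unfolded sum_quartic_exponents wt_def]
  \<comment> \<open>Each of these six monomials occurs in just one of the six products of quadrics, with coefficient 1 or -1.\<close>
  define A B C D E G where "A = c (4, 0, 0)" and "B = c (0, 0, 2)" and "C = c (0, 4, 0)"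
    and "D = c (3, 1, 0)" and "E = - c (3, 0, 1)" and "G = c (1, 3, 0)"
  note defs = A_def B_def C_def D_def E_def G_def
  have c0: "c (0, 0, 0) = 0"
    using weighted[of 0] unfolding defs by - (simp; algebra)+
  have c1: "c (1, 0, 0) = 0"
    using weighted[of 1] unfolding defs by - (simp; algebra)+
  have c2: "c (0, 1, 0) = 0"
    "c (2, 0, 0) = 0"
    using weighted[of 2] unfolding defs by - (simp; algebra)+
  have c3: "c (0, 0, 1) = 0"
    "c (1, 1, 0) = 0"
    "c (3, 0, 0) = 0"
    using weighted[of 3] unfolding defs by - (simp; algebra)+
  have c4: "c (0, 2, 0) = A"
    "c (1, 0, 1) = 0"
    "c (2, 1, 0) = (-2) * A"
    "c (4, 0, 0) = A"
    using weighted[of 4] unfolding defs by - (simp; algebra)+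
  have c5: "c (0, 1, 1) = D"
    "c (1, 2, 0) = (-1) * D"
    "c (2, 0, 1) = (-1) * D"
    "c (3, 1, 0) = D"
    using weighted[of 5] unfolding defs by - (simp; algebra)+
  have c6: "c (0, 0, 2) = B"
    "c (0, 3, 0) = (-1) * E"
    "c (1, 1, 1) = (-2) * B + E"
    "c (2, 2, 0) = B + E"
    "c (3, 0, 1) = (-1) * E"
    using weighted[of 6] unfolding defs by - (simp; algebra)+
  have c7: "c (0, 2, 1) = (-1) * G"
    "c (1, 0, 2) = G"
    "c (1, 3, 0) = G"
    "c (2, 1, 1) = (-1) * G"
    using weighted[of 7] unfolding defs by - (simp; algebra)+
  have c8: "c (0, 1, 2) = 0"
    "c (0, 4, 0) = C"
    "c (1, 2, 1) = (-2) * C"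
    "c (2, 0, 2) = C"
    using weighted[of 8] unfolding defs by - (simp; algebra)+
  have c9: "c (0, 0, 3) = 0"
    "c (0, 3, 1) = 0"
    "c (1, 1, 2) = 0"
    using weighted[of 9] unfolding defs by - (simp; algebra)+
  have c10: "c (0, 2, 2) = 0"
    "c (1, 0, 3) = 0"
    using weighted[of 10] unfolding defs by - (simp; algebra)+
  have c11: "c (0, 1, 3) = 0"
    using weighted[of 11] unfolding defs by - (simp; algebra)+
  have c12: "c (0, 0, 4) = 0"
    using weighted[of 12] unfolding defs by - (simp; algebra)+
  note cs = c0 c1 c2 c3 c4 c5 c6 c7 c8 c9 c10 c11 c12
  have "meval F x = quadric_form A B C D E G (meval q0 x) (meval q1 x) (meval q2 x)" for x
    unfolding F meval_sum sum_quartic_exponents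
    by (simp add: quartic_monomial_def cs[unfolded One_nat_def] quadric_form_def meval_quadrics) algebra
  then show thesis by (rule that)
qed

section \<open>The cuspidal condition\<close>

lemma quadric_form_smult: "quadric_form A B C D E G (t * x) (t * y) (t * z) = t ^ 2 * quadric_form A B C D E G x y z"
  by (simp add: quadric_form_def power2_eq_square algebra_simps)

text \<open>At the point with parameter \<open>r\<close> the differentials of the three quadrics span a two-dimensional
  space; they are \<open>\<phi>\<close>, \<open>\<psi> + r \<phi>\<close> and \<open>r \<psi>\<close> for two independent linear forms vanishing on the
  tangent line. The quadratic part of the plane section is the form in the quadrics evaluated on
  these differentials, a binary quadratic form in \<open>\<phi>\<close> and \<open>\<psi>\<close> whose discriminant has to vanish.\<close>

lemma cusp_imp_discriminant_relation:
  assumes F: "\<And>x. meval F x = quadric_form A B C D E G (meval q0 x) (meval q1 x) (meval q2 x)"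
    and h: "scalar_product h (osculating r $ 1) = 0" "scalar_product h (osculating r $ 2) \<noteq> 0"
    and cusp: "plane_section_has_cusp_at F h (pt (osculating r $ 1))"
  shows "(D + (2 * B + E) * r + G * r ^ 2) ^ 2 = 4 * (A + D * r + B * r ^ 2) * (B + G * r + C * r ^ 2)"
proof -
  obtain x y z where p: "pt (osculating r $ 1) = pt x"
    and span: "vec.span {x, y, z} = {v. scalar_product h v = 0}"
    and cusp: "cusp_at (\<lambda>w. meval F (x + w $ 1 *s y + w $ 2 *s z)) 0"
    using cusp unfolding plane_section_has_cusp_at_def by blast
  have "osculating r $ 1 \<noteq> 0" by (simp add: osculating_def vec4_eq_iff)
  with pt_eqD[OF p[symmetric]] obtain k where "k \<noteq> 0" "osculating r $ 1 = k *s x" by auto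
  then have "x = (1 / k) *s osculating r $ 1" "1 / k \<noteq> 0" by simp_all
  then obtain c where c: "c \<noteq> 0" "x = c *s osculating r $ 1" by blast
  define \<phi> where "\<phi> v = v $ 3 - 2 * r * v $ 2 + r ^ 2 * v $ 1" for v :: "complex ^ 4"
  define \<psi> where "\<psi> v = v $ 4 - 2 * r * v $ 3 + r ^ 2 * v $ 2" for v :: "complex ^ 4"
  have lin: "\<phi> (a *s u + b *s v) = a * \<phi> u + b * \<phi> v" "\<psi> (a *s u + b *s v) = a * \<psi> u + b * \<psi> v" for a b u v
    by (simp_all add: \<phi>_def \<psi>_def algebra_simps)
  have quadrics: "meval q0 (x + t *s v) = t * (c * \<phi> v + t * meval q0 v)"
    "meval q1 (x + t *s v) = t * (c * (\<psi> v + r * \<phi> v) + t * meval q1 v)"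
    "meval q2 (x + t *s v) = t * (c * (r * \<psi> v) + t * meval q2 v)" for t v
    by (simp_all add: meval_quadrics c(2) osculating_def \<phi>_def \<psi>_def) algebra+
  define L where "L w = w $ 1 *s y + w $ 2 *s z" for w :: "complex ^ 2"
  define g where "g t w = quadric_form A B C D E G (c * \<phi> (L w) + t * meval q0 (L w))
      (c * (\<psi> (L w) + r * \<phi> (L w)) + t * meval q1 (L w)) (c * (r * \<psi> (L w)) + t * meval q2 (L w))" for t w
  define \<alpha> where "\<alpha> = A + D * r + B * r ^ 2"
  define \<beta> where "\<beta> = D + (2 * B + E) * r + G * r ^ 2"
  define \<gamma> where "\<gamma> = B + G * r + C * r ^ 2"
  define Q where "Q s t = c ^ 2 * (\<alpha> * s ^ 2 + \<beta> * s * t + \<gamma> * t ^ 2)" for s t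
  have g0: "g 0 w = Q (w $ 1 * \<phi> y + w $ 2 * \<phi> z) (w $ 1 * \<psi> y + w $ 2 * \<psi> z)" for w
    unfolding g_def L_def lin Q_def \<alpha>_def \<beta>_def \<gamma>_def quadric_form_def by (simp, algebra)
  define a where "a = c ^ 2 * (\<alpha> * \<phi> y ^ 2 + \<beta> * \<phi> y * \<psi> y + \<gamma> * \<psi> y ^ 2)"
  define b where "b = c ^ 2 * (2 * \<alpha> * \<phi> y * \<phi> z + \<beta> * (\<phi> y * \<psi> z + \<phi> z * \<psi> y) + 2 * \<gamma> * \<psi> y * \<psi> z)"
  define d where "d = c ^ 2 * (\<alpha> * \<phi> z ^ 2 + \<beta> * \<phi> z * \<psi> z + \<gamma> * \<psi> z ^ 2)"
  have disc: "b ^ 2 = 4 * a * d"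
  proof (rule cusp_at_zero_imp_degenerate[OF cusp])
    show "meval F (x + (t *s w) $ 1 *s y + (t *s w) $ 2 *s z) = t ^ 2 * g t w" for t w
    proof -
      have "x + (t *s w) $ 1 *s y + (t *s w) $ 2 *s z = x + t *s L w"
        by (simp add: L_def vec_eq_iff algebra_simps)
      then show ?thesis by (simp only: F quadrics quadric_form_smult g_def)
    qed
    show "continuous_on UNIV (\<lambda>(t, w). g t w)"
      unfolding g_def L_def quadric_form_def \<phi>_def \<psi>_def meval_quadrics case_prod_unfold
      by (simp, intro continuous_intros)
    show "g 0 w = a * (w $ 1) ^ 2 + b * w $ 1 * w $ 2 + d * (w $ 2) ^ 2" for w
      unfolding g0 Q_def a_def b_def d_def by algebra
  qed
  have "\<phi> y * \<psi> z - \<phi> z * \<psi> y \<noteq> 0"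
  proof
    assume 0: "\<phi> y * \<psi> z - \<phi> z * \<psi> y = 0"
    have x0: "\<phi> x = 0" "\<psi> x = 0"
      by (simp_all add: c(2) \<phi>_def \<psi>_def osculating_def) algebra+
    have dep: "\<phi> u * \<psi> v = \<phi> v * \<psi> u" if uv: "scalar_product h u = 0" "scalar_product h v = 0" for u v
    proof -
      have comb: "\<exists>i j. \<phi> u = i * \<phi> y + j * \<phi> z \<and> \<psi> u = i * \<psi> y + j * \<psi> z" if "scalar_product h u = 0" for u
      proof -
        have "u \<in> vec.span {x, y, z}" using that span by blast
        then obtain k i j where "u - k *s x - i *s y = j *s z"
          by (auto simp: vec.span_insert vec.span_singleton algebra_simps)
        then have "u = 1 *s (k *s x + i *s y) + j *s z" by (simp add: algebra_simps)
        then have "\<phi> u = i * \<phi> y + j * \<phi> z \<and> \<psi> u = i * \<psi> y + j * \<psi> z"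
          by (simp only: lin) (simp add: x0)
        then show ?thesis by blast
      qed
      from comb[OF uv(1)] comb[OF uv(2)] 0 show ?thesis by (elim exE conjE) algebra
    qed
    \<comment> \<open>The last two vectors of the flag, projected along the tangent into the plane, have independent images under \<open>\<phi>\<close> and \<open>\<psi>\<close>.\<close>
    define u where "u k = osculating r $ k - (scalar_product h (osculating r $ k) / scalar_product h (osculating r $ 2)) *s osculating r $ 2" for k
    have "scalar_product h (u 3) = 0" "scalar_product h (u 4) = 0"
      using h(2) by (simp_all add: u_def)
    from dep[OF this] show False
      by (simp add: u_def \<phi>_def \<psi>_def osculating_def algebra_simps power2_eq_square)
  qed
  moreover have "c ^ 4 * (\<phi> y * \<psi> z - \<phi> z * \<psi> y) ^ 2 * (\<beta> ^ 2 - 4 * \<alpha> * \<gamma>) = 0"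
    using disc unfolding a_def b_def d_def by algebra
  ultimately have "\<beta> ^ 2 - 4 * \<alpha> * \<gamma> = 0" using c(1) by simp
  then show ?thesis by (simp add: \<alpha>_def \<beta>_def \<gamma>_def)
qed

text \<open>A plane with \<open>H h \<noteq> 0\<close> meets the cubic by the fundamental theorem of algebra; if it contains the tangent
  there, adding a generic multiple of a covector that vanishes at the point, but not on the tangent, makes it
  transversal.\<close>

lemma transversal_plane_exists:
  fixes H :: "4 mpoly"
  assumes "H \<noteq> 0"
  obtains h r where "meval H h \<noteq> 0" "scalar_product h (osculating r $ 1) = 0" "scalar_product h (osculating r $ 2) \<noteq> 0"
proof -
  have "meval (mvar 4 :: 4 mpoly) (vector [0, 0, 0, 1]) \<noteq> 0" by simp
  then have "(mvar 4 :: 4 mpoly) \<noteq> 0" by (metis meval_zero)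
  then obtain h where h: "meval H h \<noteq> 0" "h $ 4 \<noteq> 0"
    using assms mpoly_mult_eq_zero_fun[of H "mvar 4"] by auto
  have "\<exists>r. poly [:h $ 1, h $ 2, h $ 3, h $ 4:] r = 0"
    using h(2) by (intro alg_closed_imp_poly_has_root) auto
  then obtain r where r: "scalar_product h (osculating r $ 1) = 0"
    by (auto simp: scalar_product_4 osculating_def algebra_simps power2_eq_square power3_eq_cube)
  show thesis
  proof (cases "scalar_product h (osculating r $ 2) = 0")
    case False
    with h r show thesis using that by blast
  next
    case True
    define v :: "complex ^ 4" where "v = vector [- r, 1, 0, 0]"
    obtain p where p: "\<And>t. meval H (h + t *s v) = poly p t" using meval_on_line by blast
    have "p \<noteq> 0" using p[of 0] h(1) by auto
    then have "finite {t. poly p t = 0}" by (rule poly_roots_finite)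
    then have "finite (insert 0 {t. poly p t = 0})" by simp
    then obtain t where "t \<notin> insert 0 {t. poly p t = 0}"
      using ex_new_if_finite[OF infinite_UNIV_char_0] by blast
    then have t: "t \<noteq> 0" "poly p t \<noteq> 0" by auto
    have "scalar_product (h + t *s v) u = scalar_product h u + t * (u $ 2 - r * u $ 1)" for u
      unfolding scalar_product_left scalar_product_4[of v] by (simp add: v_def)
    moreover have "osculating r $ 1 $ 2 = r" "osculating r $ 1 $ 1 = 1" "osculating r $ 2 $ 2 = 1" "osculating r $ 2 $ 1 = 0"
      by (simp_all add: osculating_def)
    ultimately have "scalar_product (h + t *s v) (osculating r $ 1) = 0" "scalar_product (h + t *s v) (osculating r $ 2) = t"
      using r True by simp_all
    moreover have "meval H (h + t *s v) \<noteq> 0" by (simp add: p t)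
    ultimately show thesis using that t(1) by simp
  qed
qed

text \<open>Adding a multiple of the first coordinate covector to one such plane makes it pass through the
  point with parameter \<open>r\<close>. In this family the conditions are nonvanishing of polynomials in \<open>r\<close>, and
  these are not identically zero.\<close>

lemma transversal_planes_cofinite:
  fixes H :: "4 mpoly"
  assumes "H \<noteq> 0"
  shows "finite {r. \<not> (\<exists>h. meval H h \<noteq> 0 \<and> scalar_product h (osculating r $ 1) = 0 \<and>
    scalar_product h (osculating r $ 2) \<noteq> 0)}"
proof -
  obtain h r0 where h: "meval H h \<noteq> 0" "scalar_product h (osculating r0 $ 1) = 0" "scalar_product h (osculating r0 $ 2) \<noteq> 0"
    using assms by (rule transversal_plane_exists)
  define e :: "complex ^ 4" where "e = axis 1 (- 1)"
  define q where "q = [:h $ 1, h $ 2, h $ 3, h $ 4:]"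
  define q' where "q' = [:h $ 2, 2 * h $ 3, 3 * h $ 4:]"
  have q: "poly q r = scalar_product h (osculating r $ 1)" for r
    by (simp add: q_def scalar_product_4 osculating_def algebra_simps power2_eq_square power3_eq_cube)
  have q': "poly q' r = scalar_product h (osculating r $ 2)" for r
    by (simp add: q'_def scalar_product_4 osculating_def algebra_simps power2_eq_square)
  obtain p where p: "\<And>t. meval H (h + t *s e) = poly p t" using meval_on_line by blast
  have "poly (pcompose p q * q') r0 \<noteq> 0"
    using h p[of 0] by (simp add: poly_pcompose q q')
  then have "pcompose p q * q' \<noteq> 0" by auto
  then have "finite {r. poly (pcompose p q * q') r = 0}" by (rule poly_roots_finite)
  moreover have "\<exists>h. meval H h \<noteq> 0 \<and> scalar_product h (osculating r $ 1) = 0 \<and> scalar_product h (osculating r $ 2) \<noteq> 0"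
    if "poly (pcompose p q * q') r \<noteq> 0" for r
  proof (intro exI conjI)
    show "meval H (h + poly q r *s e) \<noteq> 0" using that by (simp add: p poly_pcompose)
    have e: "scalar_product e v = - v $ 1" for v by (simp add: e_def scalar_product_4 axis_def)
    show "scalar_product (h + poly q r *s e) (osculating r $ 1) = 0"
      by (simp add: scalar_product_left e q) (simp add: osculating_def)
    show "scalar_product (h + poly q r *s e) (osculating r $ 2) \<noteq> 0"
      using that by (simp add: scalar_product_left e q') (simp add: osculating_def)
  qed
  then have "{r. \<not> (\<exists>h. meval H h \<noteq> 0 \<and> scalar_product h (osculating r $ 1) = 0 \<and>
      scalar_product h (osculating r $ 2) \<noteq> 0)} \<subseteq> {r. poly (pcompose p q * q') r = 0}" by blast
  ultimately show ?thesis by (rule rev_finite_subset)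
qed

lemma not_irreducible_const_mult_square:
  assumes "meval S x = 0"
  shows "\<not> irreducible (mconst k * S * S)"
proof
  assume "irreducible (mconst k * S * S)"
  then have "mconst k * S dvd 1 \<or> S dvd 1" by (rule irreducibleD) simp
  then have "S dvd 1" by (auto intro: dvd_mult_right)
  then obtain T where "1 = S * T" by (rule dvdE)
  then have "meval 1 x = meval S x * meval T x" by (metis meval_mult)
  with assms show False by simp
qed

text \<open>The discriminant of a ternary quadratic form restricted to the plane perpendicular to \<open>(r\<^sup>2, -r, 1)\<close>
  is its adjugate evaluated at this vector. If it vanishes for all \<open>r\<close>, the adjugate is a multiple of
  the equation of the conic traced by \<open>(r\<^sup>2, -r, 1)\<close>. When the multiple is zero, the form has rank at
  most one; otherwise the form is a multiple of the equation \<open>y\<^sup>2 - 4 x z\<close> of the dual conic.\<close>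

lemma discriminant_relation_solutions:
  fixes A B C D E G :: complex
  assumes "\<And>r. (D + (2 * B + E) * r + G * r ^ 2) ^ 2 = 4 * (A + D * r + B * r ^ 2) * (B + G * r + C * r ^ 2)"
  shows "(\<exists>k l m n. \<forall>x y z. quadric_form A B C D E G x y z = k * (l * x + m * y + n * z) ^ 2) \<or>
    A = 0 \<and> C = 0 \<and> D = 0 \<and> G = 0 \<and> E = - 4 * B"
proof -
  have "poly [:D ^ 2 - 4 * A * B, 2 * D * (2 * B + E) - 4 * (A * G + D * B), (2 * B + E) ^ 2 + 2 * D * G - 4 * (A * C + D * G + B ^ 2),
      2 * (2 * B + E) * G - 4 * (D * C + B * G), G ^ 2 - 4 * B * C:] r = 0" for r
    using assms[of r] by simp algebra
  then have "[:D ^ 2 - 4 * A * B, 2 * D * (2 * B + E) - 4 * (A * G + D * B), (2 * B + E) ^ 2 + 2 * D * G - 4 * (A * C + D * G + B ^ 2),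
      2 * (2 * B + E) * G - 4 * (D * C + B * G), G ^ 2 - 4 * B * C:] = 0"
    using poly_all_0_iff_0 by blast
  then have e: "D ^ 2 = 4 * A * B" "D * E = 2 * A * G" "4 * B * E + E ^ 2 = 4 * A * C + 2 * D * G"
    "E * G = 2 * D * C" "G ^ 2 = 4 * B * C"
    by simp_all algebra+
  have "E = 0 \<or> E = - 4 * B" if "A = 0"
  proof -
    from that e have "E * (E + 4 * B) = 0" by (simp add: algebra_simps power2_eq_square)
    then show ?thesis by (auto simp: eq_neg_iff_add_eq_0)
  qed
  then consider "A \<noteq> 0" | "A = 0" "E = - 4 * B" "B \<noteq> 0" | "A = 0" "E = 0" "B \<noteq> 0" | "A = 0" "E = 0" "B = 0"
    by fastforce
  then show ?thesis
  proof cases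
    case 1
    have "A * (E ^ 2 - 4 * A * C) = 0" using e by algebra
    with 1 have "E ^ 2 = 4 * A * C" by simp
    then have "4 * A * quadric_form A B C D E G x y z = (2 * A * x + D * y + E * z) ^ 2" for x y z
      using e unfolding quadric_form_def by algebra
    then have "quadric_form A B C D E G x y z = 1 / (4 * A) * (2 * A * x + D * y + E * z) ^ 2" for x y z
      using 1 by (simp add: field_simps)
    then show ?thesis by blast
  next
    case 2
    with e have "D = 0" by simp
    with 2 e have "G = 0" by simp
    with 2 e have "C = 0" by simp
    with 2 \<open>D = 0\<close> \<open>G = 0\<close> show ?thesis by simp
  next
    case 3
    with e have "D = 0" by simp
    then have "4 * B * quadric_form A B C D E G x y z = (0 * x + 2 * B * y + G * z) ^ 2" for x y z
      using e 3 unfolding quadric_form_def by algebra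
    then have "quadric_form A B C D E G x y z = 1 / (4 * B) * (0 * x + 2 * B * y + G * z) ^ 2" for x y z
      using 3(3) by (simp add: field_simps)
    then show ?thesis by blast
  next
    case 4
    with e have "D = 0" "G = 0" by simp_all
    with 4 have "quadric_form A B C D E G x y z = C * (0 * x + 0 * y + 1 * z) ^ 2" for x y z
      by (simp add: quadric_form_def)
    then show ?thesis by blast
  qed
qed

text \<open>Singularity along the cubic makes \<open>F\<close> a quadratic form in the three quadrics, and the cusps restrict
  this form to a multiple of the discriminant or of a square, which irreducibility excludes.\<close>

lemma cuspidal_quartic_is_disc_form:
  fixes F :: "4 mpoly"
  assumes hom: "homogeneous 4 F" and irr: "irreducible F" and cusp: "cuspidal_curve F std_cubic"
  obtains k where "k \<noteq> 0" "F = mconst k * disc_form"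
proof -
  have nu_osc: "nu (vector [1, r]) = osculating r $ 1" for r
    by (simp add: nu_def osculating_def)
  have on_cubic: "pt (osculating r $ 1) \<in> std_cubic" for r
  proof -
    have "vector [1, r] \<noteq> (0 :: complex ^ 2)" by (simp add: vec2_eq_iff)
    then show ?thesis unfolding std_cubic_def nu_osc[symmetric] by blast
  qed
  have "gradient F (nu (vector [1, r])) = 0" for r
  proof -
    have "pt (osculating r $ 1) \<in> singular_locus F"
      using cusp on_cubic unfolding cuspidal_curve_def by blast
    then obtain x where x: "x \<noteq> 0" "pt (osculating r $ 1) = pt x" "gradient F x = 0"
      by (auto simp: singular_locus_def projectivization_def)
    from pt_eqD[OF x(2,1)] obtain c where c: "c \<noteq> 0" "x = c *s osculating r $ 1" by auto
    \<comment> \<open>The gradient of a form is homogeneous.\<close>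
    have "scalar_product (gradient F x) v = c ^ 3 * scalar_product (gradient F (osculating r $ 1)) v" for v
    proof -
      have "((\<lambda>t. meval F (x + t *s v)) has_field_derivative scalar_product (gradient F x) v) (at 0)"
        by (rule gradient_line_deriv)
      moreover have "meval F (x + t *s v) = c ^ 4 * meval F (osculating r $ 1 + t *s ((1 / c) *s v))" for t
      proof -
        have "x + t *s v = c *s (osculating r $ 1 + t *s ((1 / c) *s v))"
          using c by (simp add: vec_eq_iff algebra_simps)
        then show ?thesis by (simp only: meval_homogeneous[OF hom])
      qed
      moreover have "((\<lambda>t. c ^ 4 * meval F (osculating r $ 1 + t *s ((1 / c) *s v))) has_field_derivative
          c ^ 4 * scalar_product (gradient F (osculating r $ 1)) ((1 / c) *s v)) (at 0)"
        by (intro DERIV_cmult gradient_line_deriv)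
      ultimately have "scalar_product (gradient F x) v = c ^ 4 * scalar_product (gradient F (osculating r $ 1)) ((1 / c) *s v)"
        using DERIV_unique by simp
      then show ?thesis using c(1) by (simp add: power_eq_if)
    qed
    then have "gradient F (osculating r $ 1) $ i = 0" for i
      using x(3) c(1) scalar_product_axis[of "gradient F (osculating r $ 1)" i]
      by (metis mult_eq_0_iff power_not_zero scalar_product_simps(5))
    then show ?thesis by (simp add: nu_osc vec_eq_iff)
  qed
  then obtain A B C D E G where F: "\<And>x. meval F x = quadric_form A B C D E G (meval q0 x) (meval q1 x) (meval q2 x)"
    using singular_quartic_is_quadric_form[OF hom] by metis
  obtain d and H :: "4 mpoly" where H: "H \<noteq> 0"
    "\<And>h. h \<noteq> 0 \<and> meval H h \<noteq> 0 \<longrightarrow> (\<forall>p\<in>std_cubic \<inter> hyperplane h. plane_section_has_cusp_at F h p)"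
    using cusp unfolding cuspidal_curve_def for_general_hyperplane_def by blast
  define R where "R = [:D, 2 * B + E, G:] ^ 2 - [:4:] * [:A, D, B:] * [:B, G, C:]"
  have R: "poly R r = (D + (2 * B + E) * r + G * r ^ 2) ^ 2 - 4 * (A + D * r + B * r ^ 2) * (B + G * r + C * r ^ 2)" for r
    by (simp add: R_def algebra_simps power2_eq_square)
  have "poly R r = 0" if h: "meval H h \<noteq> 0" "scalar_product h (osculating r $ 1) = 0" "scalar_product h (osculating r $ 2) \<noteq> 0" for r h
  proof -
    have "h \<noteq> 0" using h(3) by auto
    moreover have "osculating r $ 1 \<noteq> 0" by (simp add: osculating_def vec4_eq_iff)
    then have "pt (osculating r $ 1) \<in> hyperplane h" using h(2) by (simp add: pt_in_hyperplane_iff)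
    ultimately have "plane_section_has_cusp_at F h (pt (osculating r $ 1))"
      using H(2) h(1) on_cubic by blast
    from cusp_imp_discriminant_relation[OF F h(2,3) this] show ?thesis by (simp add: R)
  qed
  then have "- {r. poly R r = 0} \<subseteq> {r. \<not> (\<exists>h. meval H h \<noteq> 0 \<and> scalar_product h (osculating r $ 1) = 0 \<and>
      scalar_product h (osculating r $ 2) \<noteq> 0)}" by blast
  then have "finite (- {r. poly R r = 0})"
    using transversal_planes_cofinite[OF H(1)] finite_subset by blast
  then have "infinite {r. poly R r = 0}" by (metis finite_compl infinite_UNIV_char_0)
  then have "R = 0" using poly_roots_finite by blast
  then have "(D + (2 * B + E) * r + G * r ^ 2) ^ 2 = 4 * (A + D * r + B * r ^ 2) * (B + G * r + C * r ^ 2)" for r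
    using R[of r] by simp
  from discriminant_relation_solutions[OF this]
  consider k l m n where "\<And>x y z. quadric_form A B C D E G x y z = k * (l * x + m * y + n * z) ^ 2"
    | "A = 0" "C = 0" "D = 0" "G = 0" "E = - 4 * B" by blast
  then show thesis
  proof cases
    case 1
    define S where "S = mconst l * q0 + mconst m * q1 + mconst n * q2"
    have "F = mconst k * S * S"
      by (rule mpoly_eqI) (simp add: F 1 S_def power2_eq_square)
    moreover have "meval S 0 = 0" by (simp add: S_def meval_quadrics)
    ultimately show thesis using irr not_irreducible_const_mult_square by blast
  next
    case 2
    have FB: "F = mconst B * disc_form"
      by (rule mpoly_eqI) (simp add: F 2 quadric_form_def meval_disc_form algebra_simps)
    have "B \<noteq> 0"
    proof
      assume "B = 0"
      then have "F = 0" by (simp add: FB mconst_def)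
      with irr show False by simp
    qed
    with FB show thesis using that by blast
  qed
qed


section \<open>Irreducibility of the discriminant form\<close>

lemma lin_subst_mult: "lin_subst A (F * G) = lin_subst A F * lin_subst A G"
  by (rule mpoly_eqI) simp

lemma lin_subst_one: "lin_subst A 1 = 1"
  by (rule mpoly_eqI) simp

lemma lin_subst_dvd_one: "F dvd 1 \<Longrightarrow> lin_subst A F dvd 1"
  by (metis dvd_def lin_subst_mult lin_subst_one)

lemma irreducible_lin_substD:
  assumes "invertible A" "irreducible (lin_subst A F)"
  shows "irreducible F"
proof -
  obtain B where B: "A ** B = mat 1" using assms(1) by (rule inverse_matrixE)
  show ?thesis
  proof (rule irreducibleI)
    have "lin_subst A 0 = 0" by (rule mpoly_eqI) simp
    then show "F \<noteq> 0" using assms(2) by auto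
    show "\<not> F dvd 1" using assms(2) lin_subst_dvd_one irreducible_not_unit by blast
    fix G H assume "F = G * H"
    then have "lin_subst A G dvd 1 \<or> lin_subst A H dvd 1"
      using irreducibleD[OF assms(2)] lin_subst_mult by blast
    then show "G dvd 1 \<or> H dvd 1"
      using lin_subst_dvd_one[of "lin_subst A G" B] lin_subst_dvd_one[of "lin_subst A H" B]
      by (auto simp: lin_subst_inverse[OF B])
  qed
qed

lemma irreducible_lin_subst_iff:
  assumes "invertible A"
  shows "irreducible (lin_subst A F) \<longleftrightarrow> irreducible F"
proof
  obtain B where B: "A ** B = mat 1" "B ** A = mat 1" "invertible B" using assms by (rule inverse_matrixE)
  assume "irreducible F"
  then have "irreducible (lin_subst B (lin_subst A F))" by (simp only: lin_subst_inverse[OF B(1)])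
  then show "irreducible (lin_subst A F)" by (rule irreducible_lin_substD[OF B(3)])
qed (rule irreducible_lin_substD[OF assms])

lemma poly_no_root_imp_const:
  fixes p :: "complex poly"
  assumes "\<And>t. poly p t \<noteq> 0"
  shows "poly p s = poly p t"
proof -
  have "degree p = 0" using assms alg_closed_imp_poly_has_root[of p] by auto
  then obtain c where "p = [:c:]" by (rule degree_eq_zeroE)
  then show ?thesis by simp
qed

text \<open>A zero of \<open>G\<close> is a zero of both factors, hence a critical point of the discriminant, and lies on the
  cone over the twisted cubic. Since this cone has codimension two, generic points can be joined by
  lines that avoid it. On such a line \<open>G\<close> is a polynomial without zeros, hence constant.\<close>

lemma cofactor_of_vanishing_factor_is_unit:
  assumes FG: "disc_form = F * G" and F: "\<And>x. meval disc_form x = 0 \<Longrightarrow> meval F x = 0"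
  shows "G dvd 1"
proof -
  have zero: "meval q0 x = 0 \<and> meval q2 x = 0" if "meval G x = 0" for x
  proof -
    have "meval F x = 0" using that by (intro F) (simp add: FG)
    with that have "gradient disc_form x = 0" by (simp add: FG)
    then show ?thesis using disc_form_critical_imp_quadrics_vanish by blast
  qed
  have line: "meval G (x + s *s axis i 1) = meval G x"
    if "\<And>t. meval q0 (x + t *s axis i 1) \<noteq> 0 \<or> meval q2 (x + t *s axis i 1) \<noteq> 0" for x i s
  proof -
    obtain p where p: "\<And>t. meval G (x + t *s axis i 1) = poly p t" using meval_on_line by blast
    have "poly p t \<noteq> 0" for t using that[of t] zero[of "x + t *s axis i 1"] p[of t] by auto
    then have "poly p s = poly p 0" by (rule poly_no_root_imp_const)
    then show ?thesis using p[of s] p[of 0] by simp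
  qed
  define k where "k = meval G (vector [0, 1, 1, 0])"
  \<comment> \<open>The path from \<open>x\<close> changes the fourth, first, second and third coordinate in turn.\<close>
  have "meval G x = k" if x: "meval q0 x \<noteq> 0" "x $ 3 \<noteq> 0" for x
  proof -
    have "meval G (vector [x $ 1, x $ 2, x $ 3, 0] + x $ 4 *s axis 4 1) = meval G (vector [x $ 1, x $ 2, x $ 3, 0])"
      using x by (intro line) (simp add: meval_quadrics axis_def)
    moreover have "vector [x $ 1, x $ 2, x $ 3, 0] + x $ 4 *s axis 4 1 = x"
      by (simp add: vec4_eq_iff axis_def)
    moreover have "meval G (vector [0, x $ 2, x $ 3, 0] + x $ 1 *s axis 1 1) = meval G (vector [0, x $ 2, x $ 3, 0])"
      using x by (intro line) (simp add: meval_quadrics axis_def)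
    moreover have "vector [0, x $ 2, x $ 3, 0] + x $ 1 *s axis 1 1 = (vector [x $ 1, x $ 2, x $ 3, 0] :: complex ^ 4)"
      by (simp add: vec4_eq_iff axis_def)
    moreover have "meval G (vector [0, 1, x $ 3, 0] + (x $ 2 - 1) *s axis 2 1) = meval G (vector [0, 1, x $ 3, 0])"
      using x by (intro line) (simp add: meval_quadrics axis_def)
    moreover have "vector [0, 1, x $ 3, 0] + (x $ 2 - 1) *s axis 2 1 = (vector [0, x $ 2, x $ 3, 0] :: complex ^ 4)"
      by (simp add: vec4_eq_iff axis_def)
    moreover have "meval G (vector [0, 1, 1, 0] + (x $ 3 - 1) *s axis 3 1) = k"
      unfolding k_def by (intro line) (simp add: meval_quadrics axis_def)
    moreover have "vector [0, 1, 1, 0] + (x $ 3 - 1) *s axis 3 1 = (vector [0, 1, x $ 3, 0] :: complex ^ 4)"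
      by (simp add: vec4_eq_iff axis_def)
    ultimately show ?thesis by simp
  qed
  then have "meval (G - mconst k) x * meval (q0 * mvar 3) x = 0" for x by auto
  then have "G - mconst k = 0 \<or> q0 * mvar 3 = 0" by (rule mpoly_mult_eq_zero_fun)
  moreover have "meval (q0 * mvar 3) (vector [1, 0, 1, 0]) \<noteq> 0" by (simp add: meval_quadrics)
  then have "q0 * mvar 3 \<noteq> 0" by (metis meval_zero)
  ultimately have G: "G = mconst k" by simp
  have "meval disc_form (vector [1, 0, 0, 1]) \<noteq> 0" by (simp add: meval_disc_form meval_quadrics)
  then have "k \<noteq> 0" by (auto simp: FG G)
  then have "1 = G * mconst (1 / k)" by (intro mpoly_eqI) (simp add: G)
  then show ?thesis by (rule dvdI)
qed

text \<open>The zeros of the discriminant are parametrized by polynomials, as products of the square of a linear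
  form with another linear form. Hence in every factorization one factor vanishes on all zeros.\<close>

lemma irreducible_disc_form: "irreducible disc_form"
proof (rule irreducibleI)
  have "meval disc_form (vector [1, 0, 0, 1]) \<noteq> 0" by (simp add: meval_disc_form meval_quadrics)
  then show "disc_form \<noteq> 0" by (metis meval_zero)
  show "\<not> disc_form dvd 1"
  proof
    assume "disc_form dvd 1"
    then obtain T where "1 = disc_form * T" by (rule dvdE)
    from arg_cong[OF this, of "\<lambda>H. meval H 0"] show False by (simp add: meval_disc_form meval_quadrics)
  qed
  fix F G assume FG: "disc_form = F * G"
  define L :: "4 \<Rightarrow> 4 mpoly" where "L i = (vector [mconst 3 * mvar 1 ^ 2 * mvar 3,
     mconst 2 * mvar 1 * mvar 2 * mvar 3 + mvar 1 ^ 2 * mvar 4,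
     mvar 2 ^ 2 * mvar 3 + mconst 2 * mvar 1 * mvar 2 * mvar 4, mconst 3 * mvar 2 ^ 2 * mvar 4] :: 4 mpoly ^ 4) $ i" for i
  have L: "(\<chi> i. meval (L i) y) = dnu (vector [y $ 1, y $ 2]) (vector [y $ 3, y $ 4])" for y
    by (simp add: L_def vec4_eq_iff dnu_def)
  have "meval (msubst L F) y * meval (msubst L G) y = 0" for y
  proof -
    have "meval disc_form (dnu (vector [y $ 1, y $ 2]) (vector [y $ 3, y $ 4])) = 0"
      unfolding meval_disc_form meval_quadrics dnu_def by (simp, algebra)
    then show ?thesis by (simp add: L FG)
  qed
  then have "msubst L F = 0 \<or> msubst L G = 0" by (rule mpoly_mult_eq_zero_fun)
  moreover have "meval H x = 0" if H: "msubst L H = 0" and x: "meval disc_form x = 0" for H x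
  proof -
    obtain s where "s \<noteq> 0" "x \<in> tangent_plane s" using x disc_form_zero_iff by blast
    then obtain m where m: "x = dnu s m" using tangent_planeE by blast
    have "meval (msubst L H) (vector [s $ 1, s $ 2, m $ 1, m $ 2]) = 0" by (simp add: H)
    moreover have "vector [s $ 1, s $ 2] = s" "vector [m $ 1, m $ 2] = m" by (simp_all add: vec2_eq_iff)
    ultimately show ?thesis by (simp add: L m)
  qed
  ultimately show "F dvd 1 \<or> G dvd 1"
    using cofactor_of_vanishing_factor_is_unit[of F G] cofactor_of_vanishing_factor_is_unit[of G F] FG
    by (auto simp: mult.commute)
qed


section \<open>The quartic surface\<close>

text \<open>Substituting \<open>(3 x\<^sub>2, 3 x\<^sub>3, 4 x\<^sub>4, 4 x\<^sub>1)\<close> for \<open>(u, v, \<alpha>, \<beta>)\<close> turns \<open>P\<close> into 27 times the discriminant form;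
  the scalar \<open>k\<close> absorbs the factor 27.\<close>

lemma quartic_P_is_disc_form:
  obtains A where "invertible A" "lin_subst A quartic_P = disc_form"
proof -
  define k :: complex where "k = csqrt (csqrt (1 / 27))"
  have "k ^ 4 = (k ^ 2) ^ 2" by (simp flip: power_mult)
  then have k: "k ^ 4 = 1 / 27" by (simp only: k_def power2_csqrt)
  define A :: "complex ^ 4 ^ 4" where
    "A = vector [vector [0, 3 * k, 0, 0], vector [0, 0, 3 * k, 0], vector [0, 0, 0, 4 * k], vector [4 * k, 0, 0, 0]]"
  define B :: "complex ^ 4 ^ 4" where
    "B = vector [vector [0, 0, 0, 1 / (4 * k)], vector [1 / (3 * k), 0, 0, 0], vector [0, 1 / (3 * k), 0, 0],
       vector [0, 0, 1 / (4 * k), 0]]"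
  have "k \<noteq> 0" using k by auto
  then have "A ** B = mat 1" "B ** A = mat 1"
    by (simp_all add: A_def B_def vec_eq_iff forall_4 matrix_matrix_mult_def sum_4 mat_def)
  then have "invertible A" unfolding invertible_def by blast
  moreover have "lin_subst A quartic_P = disc_form"
  proof (rule mpoly_eqI)
    fix x :: "complex ^ 4"
    have A_mult: "A *v x = vector [3 * k * x $ 2, 3 * k * x $ 3, 4 * k * x $ 4, 4 * k * x $ 1]"
      by (simp add: A_def vec4_eq_iff matrix_vector_mult_def sum_4)
    have "256 * meval quartic_P (A *v x) = 256 * (27 * k ^ 4 * meval disc_form x)"
      by (simp add: A_mult quartic_P_def Let_def meval_disc_form meval_quadrics) algebra
    then show "meval (lin_subst A quartic_P) x = meval disc_form x" by (simp add: k)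
  qed
  ultimately show thesis by (rule that)
qed

lemma zariski_closure_zero_locus:
  assumes "homogeneous d F"
  shows "zariski_closure (zero_locus F) = zero_locus F"
  unfolding zariski_closure_def using assms
  by (auto simp: zero_locus_def projectivization_def)

theorem theorem2p1:
  shows "homogeneous 4 quartic_P \<and> irreducible quartic_P \<and>
    (\<exists>\<Gamma>. singular_locus quartic_P = \<Gamma> \<and> twisted_cubic \<Gamma> \<and> cuspidal_curve quartic_P \<Gamma> \<and>
       zero_locus quartic_P = tangential_developable \<Gamma>) \<and>
    (\<forall>F C. homogeneous 4 F \<and> irreducible F \<and> twisted_cubic C \<and> cuspidal_curve F C \<longrightarrow>
       projectively_equivalent (zero_locus F) (zero_locus quartic_P)) \<and>
    (\<exists>D. twisted_cubic D \<and> zero_locus quartic_P = dual_surface D) \<and>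
    projectively_equivalent (zero_locus quartic_P) discriminant_surface"
proof -
  obtain A where A: "invertible A" "lin_subst A quartic_P = disc_form"
    by (rule quartic_P_is_disc_form)
  obtain B where B: "A ** B = mat 1" "B ** A = mat 1" "invertible B" using A(1) by (rule inverse_matrixE)
  have locus: "zero_locus quartic_P = proj_map A (zero_locus disc_form)"
    using zero_locus_lin_subst[OF A(1), of quartic_P] by (simp only: A(2))
  have equiv: "projectively_equivalent (zero_locus disc_form) (zero_locus quartic_P)"
    using A(1) locus by (rule projectively_equivalentI)
  have hom: "homogeneous 4 quartic_P"
    using homogeneous_lin_subst[OF homogeneous_disc_form, of B] lin_subst_inverse[OF B(1), of quartic_P]
    by (simp only: A(2))
  have irr: "irreducible quartic_P"
    using irreducible_lin_subst_iff[OF A(1), of quartic_P] irreducible_disc_form by (simp only: A(2))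
  define \<Gamma> where "\<Gamma> = proj_map A std_cubic"
  have "singular_locus quartic_P = \<Gamma>"
    using singular_locus_lin_subst[OF A(1), of quartic_P]
    by (simp only: A(2) singular_locus_disc_form \<Gamma>_def)
  moreover have "twisted_cubic \<Gamma>"
    unfolding twisted_cubic_iff \<Gamma>_def by (rule projectively_equivalentI[OF A(1) refl])
  moreover have "cuspidal_curve quartic_P \<Gamma>"
    using cuspidal_curve_lin_subst_iff[OF A(1), of quartic_P std_cubic] cuspidal_curve_disc_form
    by (simp only: A(2) \<Gamma>_def)
  moreover have "zero_locus quartic_P = tangential_developable \<Gamma>"
  proof -
    have "\<Union> (tangent_lines \<Gamma>) = proj_map A (\<Union> (tangent_lines std_cubic))"
      unfolding \<Gamma>_def tangent_lines_proj_map[OF A(1)] by blast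
    then have "\<Union> (tangent_lines \<Gamma>) = zero_locus quartic_P"
      by (simp only: union_tangent_lines_std_cubic locus)
    then show ?thesis
      by (simp only: tangential_developable_def zariski_closure_zero_locus[OF hom])
  qed
  moreover have "projectively_equivalent (zero_locus F) (zero_locus quartic_P)"
    if F: "homogeneous 4 F" "irreducible F" "twisted_cubic C" "cuspidal_curve F C" for F C
  proof -
    obtain M where M: "invertible M" "C = proj_map M std_cubic"
      using F(3) unfolding twisted_cubic_iff projectively_equivalent_def by blast
    obtain k where k: "k \<noteq> 0" "lin_subst M F = mconst k * disc_form"
    proof (rule cuspidal_quartic_is_disc_form)
      show "homogeneous 4 (lin_subst M F)" using F(1) by (rule homogeneous_lin_subst)
      show "irreducible (lin_subst M F)" using F(2) irreducible_lin_subst_iff[OF M(1)] by blast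
      show "cuspidal_curve (lin_subst M F) std_cubic"
        using F(4) unfolding M(2) by (rule cuspidal_curve_lin_subst[OF M(1)])
    qed (rule that)
    have "zero_locus (mconst k * disc_form) = zero_locus disc_form"
      by (simp add: zero_locus_def k(1))
    then have "zero_locus F = proj_map M (zero_locus disc_form)"
      using zero_locus_lin_subst[OF M(1), of F] by (simp only: k(2))
    then have "projectively_equivalent (zero_locus disc_form) (zero_locus F)"
      by (rule projectively_equivalentI[OF M(1)])
    then show ?thesis
      using equiv projectively_equivalent_sym projectively_equivalent_trans by blast
  qed
  moreover have "\<exists>D. twisted_cubic D \<and> zero_locus quartic_P = dual_surface D"
  proof -
    \<comment> \<open>\<open>N\<close> maps the surface onto the dual of the standard cubic; duality turns it into the transpose acting on the cubic.\<close>
    define N where "N = binomial_scaling ** B"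
    have N: "invertible N" "invertible (transpose N)"
      unfolding N_def using invertible_binomial_scaling B(3) invertible_mult transpose_invertible by blast+
    obtain N' where N': "N' ** N = mat 1" using N(1) by (rule inverse_matrixE)
    have "N ** A = binomial_scaling" by (simp add: N_def B(2) flip: matrix_mul_assoc)
    then have "proj_map N (zero_locus quartic_P) = dual_surface std_cubic"
      by (simp only: locus proj_map_mult dual_surface_std_cubic)
    also have "\<dots> = proj_map N (dual_surface (proj_map (transpose N) std_cubic))"
      using dual_surface_proj_map[OF N(2), of std_cubic] by (simp only: transpose_transpose)
    finally have "proj_map N' (proj_map N (zero_locus quartic_P))
        = proj_map N' (proj_map N (dual_surface (proj_map (transpose N) std_cubic)))" by (rule arg_cong)
    then have "zero_locus quartic_P = dual_surface (proj_map (transpose N) std_cubic)"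
      by (simp only: proj_map_mult N' proj_map_id)
    moreover have "twisted_cubic (proj_map (transpose N) std_cubic)"
      unfolding twisted_cubic_iff by (rule projectively_equivalentI[OF N(2) refl])
    ultimately show ?thesis by blast
  qed
  moreover have "projectively_equivalent (zero_locus quartic_P) discriminant_surface"
  proof -
    have "projectively_equivalent (zero_locus disc_form) discriminant_surface"
      by (rule projectively_equivalentI[OF invertible_binomial_scaling discriminant_surface_eq])
    then show ?thesis
      using equiv projectively_equivalent_sym projectively_equivalent_trans by blast
  qed
  ultimately show ?thesis using hom irr by blast
qed

end
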